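(* Let $\vec S$ be a submodular separation system (inside some universe), and let $\mathcal P$ be a set of profiles of $S$. Then there exists a nested set $N=N(\vec S,\mathcal P)\subseteq S$ that distinguishes all profiles in $\mathcal P$ (any two distinct elements of $\mathcal P$ orient some non-degenerate element of $N$ differently) and contains only separations which are good for $\mathcal P$. Moreover, this set $N$ can be chosen so that the following holds: if $\vec S'$ is a submodular separation system (inside some universe) and $\varphi:\vec S\to\vec S'$ is an isomorphism of separation systems such that for all $\vec r,\vec s\in\vec S$ we have $\vec r\vee\vec s\in\vec S$ if and only if $\varphi(\vec r)\vee\varphi(\vec s)\in\vec S'$ (suprema in the respective universes), then $\varphi(N(\vec S,\mathcal P))=N(\vec S',\varphi(\mathcal P))$, where $\varphi(\mathcal P)=\{\varphi(P):P\in\mathcal P\}$.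
   Context: A separation system $(\vec S,\le,{}^* )$ is a poset with an order-reversing involution ${}^*$. Elements are written $\vec s$ (oriented separations), with inverse $\overleftarrow s=(\vec s)^*$; $s=\{\vec s,\overleftarrow s\}$ is the unoriented separation with orientations $\vec s,\overleftarrow s$ (no orientation is the default one), and $S$ is the set of all such $s$. A universe $\vec U$ is a separation system that is a lattice, with supremum $\vee$ and infimum $\wedge$. $\vec S$ is submodular if it lies inside a universe $\vec U$ (i.e. $\vec S\subseteq\vec U$, with order and involution induced from $\vec U$) and for all $\vec r,\vec s\in\vec S$ at least one of $\vec r\vee\vec s$, $\vec r\wedge\vec s$ (taken in $\vec U$) lies in $\vec S$. Two separations are nested if they have comparable orientations; a set of separations is nested if its elements are pairwise nested. An isomorphism of separation systems is a bijection that is order-respecting and commutes with the involutions; it acts on unoriented separations by $\varphi(s)=\{\varphi(\vec s),\varphi(\overleftarrow s)\}$. $s$ is degenerate if $\vec s=\overleftarrow s$. An orientation of $S$ is a set $O\subseteq\vec S$ containing every degenerate separation and exactly one orientation of every non-degenerate $s\in S$. It is consistent if it does not contain both $\overleftarrow r$ and $\vec s$ whenever $\vec r<\vec s$ for distinct $r,s\in S$. A profile of $S$ is a consistent orientation $P$ of $S$ such that $(\vec r\vee\vec s)^*\notin P$ for all $\vec r,\vec s\in P$. For a profile $P$ of $S$, a separation $\vec s\in\vec S$ is closely related to $P$ if $\vec s\in P$ and $\vec s\wedge\vec r\in\vec S$ for every $\vec r\in P$. A separation $s\in S$ is good for $\mathcal P$ if there are profiles $P\neq P'$ in $\mathcal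 P$ such that $\vec s$ is closely related to $P$ and $\overleftarrow s$ is closely related to $P'$.
   Formalization: The separation systems S and S' are assumed finite (the surrounding universes may be infinite); for infinite S the claim fails, since two profiles may be distinguished by no good separation. *)

theory Defs
  imports "HOL-Algebra.Lattice"
begin

section \<open>Separation systems and universes\<close>

record 'a sepsys = "'a gorder" +
  star :: "'a \<Rightarrow> 'a"

locale separation_system = partial_order U for U :: "'a sepsys" (structure) +
  assumes star_closed: "x \<in> carrier U \<Longrightarrow> star U x \<in> carrier U"
    and star_star: "x \<in> carrier U \<Longrightarrow> star U (star U x) = x"
    and star_antimono: "\<lbrakk>x \<in> carrier U; y \<in> carrier U; x \<sqsubseteq> y\<rbrakk> \<Longrightarrow> star U y \<sqsubseteq> star U x"

locale universe = separation_system U + lattice U for U :: "'a sepsys" (structure)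

text \<open>
  A separation system inside a universe \<open>U\<close> is given by its set \<open>S\<close> of oriented separations. The
  structure induced on \<open>S\<close> is \<open>U\<lparr>carrier := S\<rparr>\<close>; the symbols \<open>\<squnion>\<^bsub>U\<^esub>\<close> and \<open>\<sqinter>\<^bsub>U\<^esub>\<close> below always
  denote supremum and infimum in \<open>U\<close>, never in \<open>S\<close>.
\<close>

definition submodular :: "'a sepsys \<Rightarrow> 'a set \<Rightarrow> bool" where
  "submodular U S \<longleftrightarrow>
     universe U \<and> S \<subseteq> carrier U \<and> separation_system (U\<lparr>carrier := S\<rparr>) \<and>
     (\<forall>r\<in>S. \<forall>s\<in>S. r \<squnion>\<^bsub>U\<^esub> s \<in> S \<or> r \<sqinter>\<^bsub>U\<^esub> s \<in> S)"

section \<open>Unoriented separations\<close>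

definition unor :: "'a sepsys \<Rightarrow> 'a \<Rightarrow> 'a set" where
  "unor U x = {x, star U x}"

definition unoriented :: "'a sepsys \<Rightarrow> 'a set \<Rightarrow> 'a set set" where
  "unoriented U S = unor U ` S"

definition degenerate :: "'a sepsys \<Rightarrow> 'a \<Rightarrow> bool" where
  "degenerate U x \<longleftrightarrow> x = star U x"

definition nested :: "'a sepsys \<Rightarrow> 'a set \<Rightarrow> 'a set \<Rightarrow> bool" where
  "nested U r s \<longleftrightarrow> (\<exists>x\<in>r. \<exists>y\<in>s. x \<sqsubseteq>\<^bsub>U\<^esub> y \<or> y \<sqsubseteq>\<^bsub>U\<^esub> x)"

definition nested_set :: "'a sepsys \<Rightarrow> 'a set set \<Rightarrow> bool" where
  "nested_set U N \<longleftrightarrow> (\<forall>r\<in>N. \<forall>s\<in>N. nested U r s)"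

section \<open>Profiles\<close>

definition orientation :: "'a sepsys \<Rightarrow> 'a set \<Rightarrow> 'a set \<Rightarrow> bool" where
  "orientation U S P \<longleftrightarrow>
     P \<subseteq> S \<and>
     (\<forall>x\<in>S. degenerate U x \<longrightarrow> x \<in> P) \<and>
     (\<forall>x\<in>S. \<not> degenerate U x \<longrightarrow> (x \<in> P \<longleftrightarrow> star U x \<notin> P))"

definition consistent :: "'a sepsys \<Rightarrow> 'a set \<Rightarrow> 'a set \<Rightarrow> bool" where
  "consistent U S P \<longleftrightarrow>
     \<not> (\<exists>r\<in>S. \<exists>s\<in>S. unor U r \<noteq> unor U s \<and> r \<sqsubset>\<^bsub>U\<^esub> s \<and> star U r \<in> P \<and> s \<in> P)"

definition profile :: "'a sepsys \<Rightarrow> 'a set \<Rightarrow> 'a set \<Rightarrow> bool" where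
  "profile U S P \<longleftrightarrow>
     orientation U S P \<and> consistent U S P \<and>
     (\<forall>r\<in>P. \<forall>s\<in>P. star U (r \<squnion>\<^bsub>U\<^esub> s) \<notin> P)"

definition closely_related :: "'a sepsys \<Rightarrow> 'a set \<Rightarrow> 'a \<Rightarrow> 'a set \<Rightarrow> bool" where
  "closely_related U S x P \<longleftrightarrow> x \<in> P \<and> (\<forall>r\<in>P. x \<sqinter>\<^bsub>U\<^esub> r \<in> S)"

definition good :: "'a sepsys \<Rightarrow> 'a set \<Rightarrow> 'a set set \<Rightarrow> 'a set \<Rightarrow> bool" where
  "good U S \<P> s \<longleftrightarrow>
     s \<in> unoriented U S \<and>
     (\<exists>x P P'. s = unor U x \<and> P \<in> \<P> \<and> P' \<in> \<P> \<and> P \<noteq> P' \<and>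
        closely_related U S x P \<and> closely_related U S (star U x) P')"

text \<open>For an unoriented separation \<open>s\<close>, the orientation of \<open>s\<close> chosen by \<open>P\<close> is recorded by \<open>s \<inter> P\<close>.\<close>

definition distinguishes :: "'a sepsys \<Rightarrow> 'a set set \<Rightarrow> 'a set set \<Rightarrow> bool" where
  "distinguishes U N \<P> \<longleftrightarrow>
     (\<forall>P\<in>\<P>. \<forall>P'\<in>\<P>. P \<noteq> P' \<longrightarrow>
        (\<exists>s\<in>N. (\<forall>x\<in>s. \<not> degenerate U x) \<and> s \<inter> P \<noteq> s \<inter> P'))"

section \<open>Canonical nested sets\<close>

definition sepsys_iso :: "'a sepsys \<Rightarrow> 'b sepsys \<Rightarrow> ('a \<Rightarrow> 'b) \<Rightarrow> bool" where
  "sepsys_iso A B \<phi> \<longleftrightarrow>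
     bij_betw \<phi> (carrier A) (carrier B) \<and>
     (\<forall>x\<in>carrier A. \<forall>y\<in>carrier A. x \<sqsubseteq>\<^bsub>A\<^esub> y \<longleftrightarrow> \<phi> x \<sqsubseteq>\<^bsub>B\<^esub> \<phi> y) \<and>
     (\<forall>x\<in>carrier A. \<phi> (star A x) = star B (\<phi> x))"

text \<open>
  A choice function \<open>N\<close> assigns a set of unoriented separations to every separation system \<open>S\<close>
  inside a universe \<open>U\<close> and every set \<open>\<P>\<close> of profiles of \<open>S\<close>. Separation systems are finite; the
  surrounding universe need not be. (Without finiteness of \<open>S\<close> there may be no good separation
  distinguishing two given profiles.)
\<close>

type_synonym 'a sep_choice = "'a sepsys \<Rightarrow> 'a set \<Rightarrow> 'a set set \<Rightarrow> 'a set set"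

definition chooses_good_nested_sets :: "'a sep_choice \<Rightarrow> bool" where
  "chooses_good_nested_sets N \<longleftrightarrow>
     (\<forall>U S \<P>. finite S \<and> submodular U S \<and> (\<forall>P\<in>\<P>. profile U S P) \<longrightarrow>
        N U S \<P> \<subseteq> unoriented U S \<and>
        nested_set U (N U S \<P>) \<and>
        distinguishes U (N U S \<P>) \<P> \<and>
        (\<forall>s\<in>N U S \<P>. good U S \<P> s))"

text \<open>
  Compatibility of choice functions with isomorphisms, from systems over the type \<open>'a\<close> to systems
  over the type \<open>'b\<close>. The isomorphism relates \<open>S\<close> and \<open>S'\<close> only, not the universes; in particular,
  the case \<open>\<phi> = id\<close> says that \<open>N U S \<P>\<close> depends on \<open>U\<close> only through the order and involution on \<open>S\<close>
  and through which suprema of elements of \<open>S\<close> lie in \<open>S\<close>.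
\<close>

definition canonical :: "'a sep_choice \<Rightarrow> 'b sep_choice \<Rightarrow> bool" where
  "canonical N N' \<longleftrightarrow>
     (\<forall>U S \<P> U' S' \<phi>.
        finite S \<and> submodular U S \<and> (\<forall>P\<in>\<P>. profile U S P) \<and>
        finite S' \<and> submodular U' S' \<and>
        sepsys_iso (U\<lparr>carrier := S\<rparr>) (U'\<lparr>carrier := S'\<rparr>) \<phi> \<and>
        (\<forall>r\<in>S. \<forall>s\<in>S. r \<squnion>\<^bsub>U\<^esub> s \<in> S \<longleftrightarrow> \<phi> r \<squnion>\<^bsub>U'\<^esub> \<phi> s \<in> S') \<longrightarrow>
        (\<lambda>s. \<phi> ` s) ` N U S \<P> = N' U' S' ((\<lambda>P. \<phi> ` P) ` \<P>))"

end

theory Submission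
  imports Defs
begin

text \<open>
  Since \<open>S\<close> is submodular, an element of \<open>S\<close> that is maximal subject to lying in a profile \<open>P\<close> and
  avoiding some other profiles is closely related to \<open>P\<close>. Among the profiles under consideration, call
  \<open>x\<close> a candidate for \<open>P\<close> if \<open>P\<close> is the only profile containing \<open>x\<close> and \<open>x\<^sup>\<star>\<close> is closely related to some other profile. The key fact is that if
  \<open>x\<close> is closely related to \<open>P\<close>, \<open>y\<close> is closely related to \<open>Q\<close> and \<open>x \<in> Q\<close>, then \<open>x \<sqinter> y\<close> is closely
  related to \<open>P\<close>. It implies that the candidates for \<open>P\<close> are closed under joins, so that there is a
  greatest one (if any), that this one is good, that the greatest candidates for different profiles
  are nested, and that some profile has a candidate as long as two profiles are left. The greatest
  candidates are collected, their profiles are discarded, and the construction is repeated with the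
  remaining profiles and those separations \<open>x\<close> with \<open>x \<sqsubseteq> r\<close> or \<open>x\<^sup>\<star> \<sqsubseteq> r\<close> for every collected \<open>r\<close>. No
  choices are made, so the result is canonical.
\<close>

section \<open>Profiles and closely related separations\<close>

locale submodular_system = universe U for U :: "'a sepsys" (structure) +
  fixes S
  assumes finite_S: "finite S"
    and S_carrier [simp]: "x \<in> S \<Longrightarrow> x \<in> carrier U"
    and star_S [simp]: "x \<in> S \<Longrightarrow> star U x \<in> S"
    and join_or_meet: "\<lbrakk>r \<in> S; s \<in> S\<rbrakk> \<Longrightarrow> r \<squnion> s \<in> S \<or> r \<sqinter> s \<in> S"
begin

abbreviation reversal (\<open>_\<^sup>\<star>\<close> [1000] 1000) where "x\<^sup>\<star> \<equiv> star U x"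
abbreviation "prof \<equiv> profile U S"
abbreviation "close \<equiv> closely_related U S"

section \<open>Involution, De Morgan laws and extremal elements\<close>

lemmas [simp] = star_closed star_star

lemma star_le: "\<lbrakk>x\<^sup>\<star> \<sqsubseteq> y; x \<in> carrier U; y \<in> carrier U\<rbrakk> \<Longrightarrow> y\<^sup>\<star> \<sqsubseteq> x"
  using star_antimono[of "x\<^sup>\<star>" y] by simp

lemma le_star: "\<lbrakk>x \<sqsubseteq> y\<^sup>\<star>; x \<in> carrier U; y \<in> carrier U\<rbrakk> \<Longrightarrow> y \<sqsubseteq> x\<^sup>\<star>"
  using star_antimono[of x "y\<^sup>\<star>"] by simp

lemma star_join:
  assumes "x \<in> carrier U" "y \<in> carrier U"
  shows "(x \<squnion> y)\<^sup>\<star> = x\<^sup>\<star> \<sqinter> y\<^sup>\<star>"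
proof (rule le_antisym)
  show "(x \<squnion> y)\<^sup>\<star> \<sqsubseteq> x\<^sup>\<star> \<sqinter> y\<^sup>\<star>"
    using assms by (intro meet_le star_antimono join_left join_right) auto
  have "x \<sqsubseteq> (x\<^sup>\<star> \<sqinter> y\<^sup>\<star>)\<^sup>\<star>" "y \<sqsubseteq> (x\<^sup>\<star> \<sqinter> y\<^sup>\<star>)\<^sup>\<star>"
    using assms by (simp_all add: le_star meet_left meet_right)
  then have "x \<squnion> y \<sqsubseteq> (x\<^sup>\<star> \<sqinter> y\<^sup>\<star>)\<^sup>\<star>"
    using assms by (simp add: join_le)
  then show "x\<^sup>\<star> \<sqinter> y\<^sup>\<star> \<sqsubseteq> (x \<squnion> y)\<^sup>\<star>"
    using assms by (simp add: le_star)
qed (use assms in auto)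

lemma star_meet: "\<lbrakk>x \<in> carrier U; y \<in> carrier U\<rbrakk> \<Longrightarrow> (x \<sqinter> y)\<^sup>\<star> = x\<^sup>\<star> \<squnion> y\<^sup>\<star>"
  using star_join[of "x\<^sup>\<star>" "y\<^sup>\<star>"] by (metis join_closed star_closed star_star)

lemma star_in_S_iff: "x \<in> carrier U \<Longrightarrow> x\<^sup>\<star> \<in> S \<longleftrightarrow> x \<in> S"
  using star_S[of "x\<^sup>\<star>"] by auto

lemma star_meet_in_S_iff: "\<lbrakk>x \<in> carrier U; y \<in> carrier U\<rbrakk> \<Longrightarrow> x\<^sup>\<star> \<sqinter> y\<^sup>\<star> \<in> S \<longleftrightarrow> x \<squnion> y \<in> S"
  by (metis star_join star_in_S_iff join_closed)

lemma S_maximal: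
  assumes "A \<subseteq> S" "x \<in> A"
  obtains m where "m \<in> A" "x \<sqsubseteq> m" "\<And>y. \<lbrakk>y \<in> A; m \<sqsubseteq> y\<rbrakk> \<Longrightarrow> y = m"
proof -
  let ?B = "{y \<in> A. x \<sqsubseteq> y}"
  have A: "a \<in> carrier U" if "a \<in> A" for a using that assms by auto
  have "finite ?B" using finite_subset[OF assms(1) finite_S] by simp
  moreover have "asymp_on ?B (\<lambda>a b. a \<sqsubset> b)"
    by (rule asymp_onI) (metis (no_types, lifting) A lless_antisym mem_Collect_eq)
  moreover have "transp_on ?B (\<lambda>a b. a \<sqsubset> b)"
    by (rule transp_onI) (metis (no_types, lifting) A lless_trans mem_Collect_eq)
  moreover have "?B \<noteq> {}" using assms A by auto
  ultimately obtain m where m: "m \<in> ?B" "\<And>y. \<lbrakk>y \<in> ?B; y \<noteq> m\<rbrakk> \<Longrightarrow> \<not> m \<sqsubset> y"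
    using Finite_Set.bex_max_element[of ?B "\<lambda>a b. a \<sqsubset> b"] by blast
  have "y = m" if y: "y \<in> A" "m \<sqsubseteq> y" for y
  proof -
    have "x \<sqsubseteq> y" using m(1) y A assms(2) le_trans by (metis (no_types, lifting) mem_Collect_eq)
    then show ?thesis using m(2)[of y] y by (auto simp: lless_eq)
  qed
  then show ?thesis using that m(1) by blast
qed

lemma S_minimal:
  assumes "A \<subseteq> S" "x \<in> A"
  obtains m where "m \<in> A" "m \<sqsubseteq> x" "\<And>y. \<lbrakk>y \<in> A; y \<sqsubseteq> m\<rbrakk> \<Longrightarrow> y = m"
proof -
  let ?B = "{y \<in> A. y \<sqsubseteq> x}"
  have A: "a \<in> carrier U" if "a \<in> A" for a using that assms by auto
  have "finite ?B" using finite_subset[OF assms(1) finite_S] by simp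
  moreover have "asymp_on ?B (\<lambda>a b. a \<sqsubset> b)"
    by (rule asymp_onI) (metis (no_types, lifting) A lless_antisym mem_Collect_eq)
  moreover have "transp_on ?B (\<lambda>a b. a \<sqsubset> b)"
    by (rule transp_onI) (metis (no_types, lifting) A lless_trans mem_Collect_eq)
  moreover have "?B \<noteq> {}" using assms A by auto
  ultimately obtain m where m: "m \<in> ?B" "\<And>y. \<lbrakk>y \<in> ?B; y \<noteq> m\<rbrakk> \<Longrightarrow> \<not> y \<sqsubset> m"
    using Finite_Set.bex_min_element[of ?B "\<lambda>a b. a \<sqsubset> b"] by blast
  have "y = m" if y: "y \<in> A" "y \<sqsubseteq> m" for y
  proof -
    have "y \<sqsubseteq> x" using m(1) y A assms(2) le_trans by (metis (no_types, lifting) mem_Collect_eq)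
    then show ?thesis using m(2)[of y] y by (auto simp: lless_eq)
  qed
  then show ?thesis using that m(1) by blast
qed

section \<open>Closure properties of profiles\<close>

lemma prof_S [simp]: "\<lbrakk>prof P; x \<in> P\<rbrakk> \<Longrightarrow> x \<in> S"
  unfolding profile_def orientation_def by blast

lemma prof_star: "\<lbrakk>prof P; x \<in> S; x \<notin> P\<rbrakk> \<Longrightarrow> x\<^sup>\<star> \<in> P"
  unfolding profile_def orientation_def by blast

lemma prof_degenerate: "\<lbrakk>prof P; x \<in> P; x\<^sup>\<star> \<in> P\<rbrakk> \<Longrightarrow> x\<^sup>\<star> = x"
  unfolding profile_def orientation_def degenerate_def by fastforce

lemma prof_degenerate_mem: "\<lbrakk>prof P; x \<in> S; x\<^sup>\<star> = x\<rbrakk> \<Longrightarrow> x \<in> P"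
  unfolding profile_def orientation_def degenerate_def by (metis (lifting))

lemma prof_join: "\<lbrakk>prof P; x \<in> P; y \<in> P; x \<squnion> y \<in> S\<rbrakk> \<Longrightarrow> x \<squnion> y \<in> P"
  using prof_star[of P "x \<squnion> y"] unfolding profile_def by blast

text \<open>
  Profiles need not be down-closed: they may contain some \<open>x\<close> with \<open>x\<^sup>\<star> \<sqsubset> x\<close>. This is the only
  exception.
\<close>

lemma prof_down:
  assumes "prof P" "x \<in> P" "z \<in> S" "z \<sqsubseteq> x" "z \<notin> P"
  shows "z = x\<^sup>\<star>"
proof (rule ccontr)
  assume ne: "z \<noteq> x\<^sup>\<star>"
  have zx: "z \<noteq> x" "x \<in> S" "z\<^sup>\<star> \<in> P" using assms prof_star by auto
  have "unor U z \<noteq> unor U x"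
    using ne zx by (auto simp: unor_def doubleton_eq_iff)
  moreover have "z \<sqsubset> x" using assms zx by (simp add: lless_eq)
  ultimately show False
    using assms zx unfolding profile_def consistent_def by blast
qed

text \<open>The profile axiom speaks of joins only. By \<open>prof_down\<close> a meet outside
  \<open>P\<close> would equal both \<open>x\<^sup>\<star>\<close> and
  \<open>y\<^sup>\<star>\<close>, so that \<open>x = y\<close> and the meet is \<open>x\<close>
  itself.\<close>

lemma prof_meet:
  assumes "prof P" "x \<in> P" "y \<in> P" "x \<sqinter> y \<in> S"
  shows "x \<sqinter> y \<in> P"
proof (rule ccontr)
  assume n: "x \<sqinter> y \<notin> P"
  have c: "x \<in> carrier U" "y \<in> carrier U" using assms by auto
  have "x \<sqinter> y = x\<^sup>\<star>" "x \<sqinter> y = y\<^sup>\<star>"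
    using prof_down[OF assms(1) _ assms(4) _ n] assms(2,3) meet_left[OF c] meet_right[OF c] by auto
  then have "x = y" using c by (metis star_star)
  then show False using n assms c by (metis le_iff_join le_refl)
qed

text \<open>Stands in for down-closure. The exceptional case \<open>z = x\<^sup>\<star>\<close>
  would put both orientations into \<open>P\<close>, so \<open>x\<close> would be degenerate and
  \<open>z\<close> equal to \<open>x\<close>.\<close>

lemma prof_transfer:
  assumes "prof P" "prof Q" "x \<in> P" "x \<in> Q" "z \<in> P" "z \<sqsubseteq> x"
  shows "z \<in> Q"
proof (rule ccontr)
  assume n: "z \<notin> Q"
  then have "z = x\<^sup>\<star>" using prof_down[of Q x z] assms by auto
  then show False using assms n prof_degenerate by metis
qed

section \<open>Closely related separations under meets\<close>

lemma closeD: "\<lbrakk>close x P; r \<in> P\<rbrakk> \<Longrightarrow> x \<sqinter> r \<in> S"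
  by (auto simp: closely_related_def)

lemma close_mem: "close x P \<Longrightarrow> x \<in> P"
  by (auto simp: closely_related_def)

lemma close_meet_mem: "\<lbrakk>prof P; close x P; r \<in> P\<rbrakk> \<Longrightarrow> x \<sqinter> r \<in> P"
  by (simp add: closeD close_mem prof_meet)

lemma meet_assoc: "\<lbrakk>x \<in> carrier U; y \<in> carrier U; z \<in> carrier U\<rbrakk> \<Longrightarrow> x \<sqinter> y \<sqinter> z = x \<sqinter> (y \<sqinter> z)"
  using weak_meet_assoc eq_is_equal by simp

text \<open>The key fact. As \<open>P\<close> and \<open>Q\<close> share \<open>x\<close>, elements
  below \<open>x\<close> pass from one to the other by \<open>prof_transfer\<close>: for
  \<open>r \<in> P\<close>, the meet \<open>x \<sqinter> r\<close> lies in \<open>P\<close>, hence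
  in \<open>Q\<close>, and closeness of \<open>y\<close> to \<open>Q\<close> puts its meet with
  \<open>y\<close> into \<open>S\<close>.\<close>

lemma close_meet:
  assumes P: "prof P" and Q: "prof Q" and x: "close x P" "x \<in> Q" and y: "close y Q"
  shows "close (x \<sqinter> y) P"
proof -
  note mem = close_mem[OF x(1)] close_mem[OF y]
  have S: "x \<in> S" "y \<in> S" using mem P Q by auto
  have xyQ: "x \<sqinter> y \<in> Q"
    using close_meet_mem[OF Q y x(2)] by (simp add: meet_comm)
  have "x \<sqinter> y \<in> P"
    using prof_transfer[OF Q P x(2) mem(1) xyQ] S by (simp add: meet_left)
  moreover have "x \<sqinter> y \<sqinter> r \<in> S" if r: "r \<in> P" for r
  proof -
    have xr: "x \<sqinter> r \<in> P" using close_meet_mem[OF P x(1) r] .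
    have rS: "r \<in> S" using r P by auto
    have "x \<sqinter> r \<in> Q"
      using prof_transfer[OF P Q mem(1) x(2) xr] S rS by (simp add: meet_left)
    then have "y \<sqinter> (x \<sqinter> r) \<in> S" using closeD[OF y] by simp
    then show ?thesis using S rS by (metis meet_assoc meet_comm S_carrier)
  qed
  ultimately show ?thesis by (simp add: closely_related_def)
qed

text \<open>The key fact for inverses, which De Morgan turns into joins inside
  \<open>S\<close>.\<close>

lemma close_star_join:
  assumes "prof P" "prof Q" "close (x\<^sup>\<star>) P" "x\<^sup>\<star> \<in> Q" "close (y\<^sup>\<star>) Q" "x \<in> S" "y \<in> S"
  shows "x \<squnion> y \<in> S" "close ((x \<squnion> y)\<^sup>\<star>) P"
  using close_meet[of P Q "x\<^sup>\<star>" "y\<^sup>\<star>"] assms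
  by (auto simp: star_join dest: closeD simp flip: star_meet_in_S_iff) (metis closeD meet_comm)

lemma prof_up_notin:
  assumes "prof P" "prof Q" "x \<in> P" "x \<notin> Q" "y \<in> P" "x \<sqsubseteq> y"
  shows "y \<notin> Q"
  using assms prof_transfer by blast

lemma meet_absorb: "\<lbrakk>x \<sqsubseteq> y; x \<in> carrier U; y \<in> carrier U\<rbrakk> \<Longrightarrow> x \<sqinter> y = x"
  using le_iff_join by simp

lemma meet_absorb_middle:
  "\<lbrakk>x \<sqsubseteq> y; x \<in> carrier U; y \<in> carrier U; z \<in> carrier U\<rbrakk> \<Longrightarrow> x \<sqinter> (y \<sqinter> z) = x \<sqinter> z"
  using meet_assoc[of x y z] meet_absorb[of x y] by simp

text \<open>Lets \<open>extend\<close> pass to a minimal witness of failing closeness without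
  leaving \<open>P\<close>. The only obstacle is \<open>p = q\<^sup>\<star>\<close>. Submodularity
  then gives both joins with \<open>x\<close>, and they lie in \<open>P\<close>; now
  \<open>p \<sqsubseteq> x \<squnion> p\<close> forces
  \<open>p = (x \<squnion> p)\<^sup>\<star>\<close>, whence \<open>x \<sqsubseteq> q\<close>, which
  contradicts \<open>x \<sqinter> q \<notin> S\<close>.\<close>

lemma not_close_below:
  assumes P: "prof P" "x \<in> P" "q \<in> P" "x \<sqinter> q \<notin> S" and p: "p \<in> S" "p \<sqsubseteq> q" "x \<sqinter> p \<notin> S"
  shows "p \<in> P"
proof (rule ccontr)
  assume n: "p \<notin> P"
  have S: "x \<in> S" "q \<in> S" using P by auto
  have c: "x \<in> carrier U" "p \<in> carrier U" "q \<in> carrier U" using S p by auto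
  have pq: "p = q\<^sup>\<star>" using prof_down[OF P(1,3) p(1,2) n] .
  have j: "x \<squnion> q \<in> S" "x \<squnion> p \<in> S"
    using join_or_meet[of x q] join_or_meet[of x p] S p P by blast+
  have jq: "x \<squnion> q \<in> P" using prof_join P j by blast
  have "x \<squnion> p \<sqsubseteq> x \<squnion> q"
    using c p le_trans[OF p(2) join_right] by (intro join_le join_left) auto
  moreover have "x \<squnion> p \<noteq> (x \<squnion> q)\<^sup>\<star>"
  proof
    assume "x \<squnion> p = (x \<squnion> q)\<^sup>\<star>"
    then have "x \<squnion> p \<sqsubseteq> p" using c pq by (simp add: star_join meet_right)
    then have "x \<sqsubseteq> p" using join_left[of x p] le_trans[of x "x \<squnion> p" p] c by simp
    then show False using meet_absorb[of x p] c p S by simp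
  qed
  ultimately have jp: "x \<squnion> p \<in> P" using prof_down[OF P(1) jq j(2)] by blast
  then have "p = (x \<squnion> p)\<^sup>\<star>" using prof_down[OF P(1) jp p(1) _ n] c join_right by blast
  then have "p \<sqsubseteq> x\<^sup>\<star>" using c star_join[of x p] meet_left[of "x\<^sup>\<star>" "p\<^sup>\<star>"] by simp
  then have "x \<sqsubseteq> q" using le_star[of p x] c pq by simp
  then show False using meet_absorb[of x q] c P S by simp
qed

end

section \<open>One stage of the construction\<close>

text \<open>\<open>M\<close> will hold separations oriented so that every profile still under
  consideration contains \<open>r\<^sup>\<star>\<close>. The condition says that
  \<open>r\<^sup>\<star>\<close> is below an orientation of \<open>x\<close>, so \<open>x\<close>
  lives on the side of those profiles; this is stronger than nestedness with
  \<open>r\<close>.\<close>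

definition around :: "'a sepsys \<Rightarrow> 'a set \<Rightarrow> 'a set \<Rightarrow> 'a set" where
  "around U S M = {x \<in> S. \<forall>r\<in>M. x \<sqsubseteq>\<^bsub>U\<^esub> r \<or> star U x \<sqsubseteq>\<^bsub>U\<^esub> r}"

definition candidates :: "'a sepsys \<Rightarrow> 'a set \<Rightarrow> 'a set \<Rightarrow> 'a set set \<Rightarrow> 'a set \<Rightarrow> 'a set" where
  "candidates U S M \<Q> P =
     {x \<in> around U S M. x \<in> P \<and> (\<forall>R\<in>\<Q>. R \<noteq> P \<longrightarrow> x \<notin> R) \<and>
        (\<exists>R\<in>\<Q>. R \<noteq> P \<and> closely_related U S (star U x) R)}"

text \<open>Kept as a set with at most one element: no choice enters, and emptiness marks the
  profiles that stay in the process.\<close>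

definition tops :: "'a sepsys \<Rightarrow> 'a set \<Rightarrow> 'a set \<Rightarrow> 'a set set \<Rightarrow> 'a set \<Rightarrow> 'a set" where
  "tops U S M \<Q> P = {x \<in> candidates U S M \<Q> P. \<forall>y\<in>candidates U S M \<Q> P. y \<sqsubseteq>\<^bsub>U\<^esub> x}"

definition new_separations :: "'a sepsys \<Rightarrow> 'a set \<Rightarrow> 'a set \<Rightarrow> 'a set set \<Rightarrow> 'a set" where
  "new_separations U S M \<Q> = (\<Union>P\<in>\<Q>. tops U S M \<Q> P)"

definition remaining :: "'a sepsys \<Rightarrow> 'a set \<Rightarrow> 'a set \<Rightarrow> 'a set set \<Rightarrow> 'a set set" where
  "remaining U S M \<Q> = {P \<in> \<Q>. tops U S M \<Q> P = {}}"

text \<open>The invariant of the iteration, with \<open>M\<close> collected so far and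
  \<open>\<Q>\<close> the profiles not yet split off. \<open>separated\<close> lets the process
  continue inside the admissible separations; \<open>settled\<close> makes \<open>M\<close>
  distinguish all of \<open>\<P>\<close> once at most one profile is left.\<close>

locale stage = submodular_system U S for U :: "'a sepsys" (structure) and S +
  fixes \<P> M \<Q>
  assumes profiles: "P \<in> \<P> \<Longrightarrow> profile U S P"
    and subset: "\<Q> \<subseteq> \<P>"
    and good_M: "r \<in> M \<Longrightarrow>
      \<exists>P\<in>\<P>. \<exists>P'\<in>\<P>. P \<noteq> P' \<and> closely_related U S r P \<and> closely_related U S (star U r) P'"
    and M_notin: "\<lbrakk>r \<in> M; P \<in> \<Q>\<rbrakk> \<Longrightarrow> r \<notin> P"
    and M_nested: "\<lbrakk>r \<in> M; s \<in> M\<rbrakk> \<Longrightarrow> r \<sqsubseteq> s \<or> s \<sqsubseteq> r \<or> star U r \<sqsubseteq> s"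
    and separated: "\<lbrakk>P \<in> \<Q>; Q \<in> \<Q>; P \<noteq> Q\<rbrakk> \<Longrightarrow> \<exists>s\<in>around U S M. s \<in> P \<and> s \<notin> Q"
    and settled: "\<lbrakk>P \<in> \<P>; Q \<in> \<P>; P \<noteq> Q; \<not> (P \<in> \<Q> \<and> Q \<in> \<Q>)\<rbrakk> \<Longrightarrow> \<exists>r\<in>M. (r \<in> P) \<noteq> (r \<in> Q)"
begin

section \<open>Separations admissible at a stage\<close>

abbreviation "K \<equiv> around U S M"

lemma prof_Q: "P \<in> \<Q> \<Longrightarrow> prof P"
  using profiles subset by auto

lemma K_S [simp]: "x \<in> K \<Longrightarrow> x \<in> S"
  by (simp add: around_def)

lemma M_S [simp]: "r \<in> M \<Longrightarrow> r \<in> S"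
  using good_M[of r] close_mem prof_S profiles by metis

lemma M_star: "\<lbrakk>r \<in> M; P \<in> \<Q>\<rbrakk> \<Longrightarrow> r\<^sup>\<star> \<in> P"
  using M_notin prof_star prof_Q M_S by metis

lemma K_star: "x \<in> K \<Longrightarrow> x\<^sup>\<star> \<in> K"
  unfolding around_def by auto

lemma K_join:
  assumes "x \<in> K" "y \<in> K" "x \<squnion> y \<in> S"
  shows "x \<squnion> y \<in> K"
proof -
  have c: "x \<in> carrier U" "y \<in> carrier U" using assms by auto
  have "x \<squnion> y \<sqsubseteq> r \<or> (x \<squnion> y)\<^sup>\<star> \<sqsubseteq> r" if r: "r \<in> M" for r
  proof -
    have rc: "r \<in> carrier U" using r by simp
    consider "x \<sqsubseteq> r" "y \<sqsubseteq> r" | "x\<^sup>\<star> \<sqsubseteq> r" | "y\<^sup>\<star> \<sqsubseteq> r"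
      using assms r unfolding around_def by blast
    then show ?thesis
    proof cases
      case 1
      then show ?thesis using join_le c rc by blast
    next
      case 2
      then show ?thesis
        using c rc le_trans[OF meet_left 2] by (simp add: star_join)
    next
      case 3
      then show ?thesis
        using c rc le_trans[OF meet_right 3] by (simp add: star_join)
    qed
  qed
  then show ?thesis using assms unfolding around_def by blast
qed

lemma K_meet: "\<lbrakk>x \<in> K; y \<in> K; x \<sqinter> y \<in> S\<rbrakk> \<Longrightarrow> x \<sqinter> y \<in> K"
  using K_join[of "x\<^sup>\<star>" "y\<^sup>\<star>"] K_star star_meet[of x y] star_S[of "x \<sqinter> y"]
  by (metis K_S S_carrier star_star)

text \<open>
  If \<open>x \<sqinter> p \<notin> S\<close> with \<open>p \<in> P\<close> minimal, then \<open>x \<squnion> p\<close> lies in \<open>S\<close> but perhaps not in \<open>K\<close>. Joining it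
  with \<open>r\<^sup>\<star>\<close> for all those \<open>r \<in> M\<close> above \<open>x\<close> whose profile does not contain \<open>p\<close> leads back to \<open>K\<close>.
\<close>

lemma extend:
  assumes P: "P \<in> \<Q>" and x: "x \<in> K" "x \<in> P" "\<not> close x P"
  obtains y where "y \<in> K" "y \<in> P" "x \<sqsubseteq> y" "y \<noteq> x"
    "\<And>Q. \<lbrakk>prof Q; close (x\<^sup>\<star>) Q\<rbrakk> \<Longrightarrow> close (y\<^sup>\<star>) Q"
proof -
  note pP = prof_Q[OF P]
  \<comment> \<open>Fix for each \<open>r\<close> one profile to which it is close; whether this
    profile contains \<open>p\<close> decides how \<open>r\<close> is treated.\<close>
  obtain f where f: "\<And>r. r \<in> M \<Longrightarrow> prof (f r)" "\<And>r. r \<in> M \<Longrightarrow> close r (f r)"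
    using good_M profiles by metis
  obtain q where q: "q \<in> P" "x \<sqinter> q \<notin> S"
    using x by (auto simp: closely_related_def)
  define A where "A = {p \<in> S. p \<sqsubseteq> q \<and> x \<sqinter> p \<notin> S}"
  have "q \<in> A" using q pP by (simp add: A_def)
  then obtain p where p: "p \<in> A" "\<And>a. \<lbrakk>a \<in> A; a \<sqsubseteq> p\<rbrakk> \<Longrightarrow> a = p"
    using S_minimal[of A q] by (auto simp: A_def)
  have pS: "p \<in> S" "p \<sqsubseteq> q" "x \<sqinter> p \<notin> S" using p by (auto simp: A_def)
  have pP': "p \<in> P" using not_close_below[OF pP x(2) q pS] .
  have c: "x \<in> carrier U" "p \<in> carrier U" "q \<in> carrier U" using x pS q pP by auto
  have min: "a = p" if "a \<in> S" "a \<sqsubseteq> p" "x \<sqinter> a \<notin> S" for a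
    using p(2)[of a] that le_trans[of a p q] pS c by (simp add: A_def)
  \<comment> \<open>Closeness puts \<open>r \<sqinter> p\<close> into \<open>S\<close>, and as
    \<open>x \<sqsubseteq> r\<close> its meet with \<open>x\<close> is still
    \<open>x \<sqinter> p\<close>. Minimality leaves only \<open>r \<sqinter> p = p\<close>.\<close>
  have pr: "p \<sqsubseteq> r" if r: "r \<in> M" "x \<sqsubseteq> r" "p \<in> f r" for r
  proof -
    have rc: "r \<in> carrier U" using r by simp
    have "r \<sqinter> p \<in> S" using closeD[OF f(2)] r by simp
    moreover have "x \<sqinter> (r \<sqinter> p) \<notin> S" using meet_absorb_middle[of x r p] r c rc pS by simp
    ultimately have "r \<sqinter> p = p" using min[of "r \<sqinter> p"] meet_right[of r p] c rc by simp
    then show ?thesis using meet_left[of r p] c rc by simp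
  qed
  have j: "x \<squnion> p \<in> S" using join_or_meet[of x p] x pS by simp
  have jP: "x \<squnion> p \<in> P" using prof_join[OF pP x(2) pP' j] .
  have close_j: "close ((x \<squnion> p)\<^sup>\<star>) Q" if Q: "prof Q" "close (x\<^sup>\<star>) Q" for Q
  proof -
    \<comment> \<open>Otherwise \<open>prof_down\<close> makes this inverse equal to
      \<open>x\<close>, so \<open>P\<close> contains both \<open>x\<close> and
      \<open>x\<^sup>\<star>\<close>, and \<open>x\<close> is degenerate.\<close>
    have "(x \<squnion> p)\<^sup>\<star> \<in> Q"
    proof (rule ccontr)
      assume n: "(x \<squnion> p)\<^sup>\<star> \<notin> Q"
      have "(x \<squnion> p)\<^sup>\<star> \<sqsubseteq> x\<^sup>\<star>" using c by (simp add: star_join meet_left)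
      then have e: "(x \<squnion> p)\<^sup>\<star> = x"
        using prof_down[OF Q(1) close_mem[OF Q(2)] _ _ n] j c by simp
      then have "x \<squnion> p = x\<^sup>\<star>" using j by (metis star_star S_carrier)
      then have "x\<^sup>\<star> = x" using prof_degenerate[OF pP x(2)] jP by simp
      then show False using e n close_mem[OF Q(2)] by simp
    qed
    moreover have "(x \<squnion> p)\<^sup>\<star> \<sqinter> s \<in> S" if s: "s \<in> Q" for s
    proof -
      have sc: "s \<in> carrier U" using s Q by simp
      define t where "t = x\<^sup>\<star> \<sqinter> s"
      have t: "t \<in> S" "t \<sqsubseteq> x\<^sup>\<star>"
        using closeD[OF Q(2) s] meet_left[of "x\<^sup>\<star>" s] sc c by (simp_all add: t_def)
      have tc: "t \<in> carrier U" using t by simp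
      \<comment> \<open>If not, submodularity gives
        \<open>t\<^sup>\<star> \<sqinter> p \<in> S\<close>, another witness below \<open>p\<close>.
        By minimality \<open>p \<sqsubseteq> t\<^sup>\<star>\<close>, so the meet in question is
        \<open>t\<close>, which is in \<open>S\<close>.\<close>
      have "p\<^sup>\<star> \<sqinter> t \<in> S"
      proof (rule ccontr)
        assume n: "p\<^sup>\<star> \<sqinter> t \<notin> S"
        then have "p\<^sup>\<star> \<squnion> t \<in> S" using join_or_meet[of "p\<^sup>\<star>" t] t pS by simp
        then have "t\<^sup>\<star> \<sqinter> p \<in> S"
          using star_S[of "p\<^sup>\<star> \<squnion> t"] c tc by (simp add: star_join meet_comm)
        moreover have "x \<sqsubseteq> t\<^sup>\<star>" using le_star[OF t(2)] tc c by simp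
        then have "x \<sqinter> (t\<^sup>\<star> \<sqinter> p) \<notin> S" using meet_absorb_middle[of x "t\<^sup>\<star>" p] c tc pS by simp
        ultimately have "t\<^sup>\<star> \<sqinter> p = p" using min[of "t\<^sup>\<star> \<sqinter> p"] meet_right[of "t\<^sup>\<star>" p] c tc by simp
        then have "p \<sqsubseteq> t\<^sup>\<star>" using meet_left[of "t\<^sup>\<star>" p] c tc by simp
        then have "t \<sqsubseteq> p\<^sup>\<star>" using le_star[of p t] tc c by simp
        then show False using n t meet_absorb[of t "p\<^sup>\<star>"] tc c by (simp add: meet_comm)
      qed
      moreover have "(x \<squnion> p)\<^sup>\<star> \<sqinter> s = p\<^sup>\<star> \<sqinter> t"
        using c sc meet_assoc[of "p\<^sup>\<star>" "x\<^sup>\<star>" s] by (simp add: star_join t_def meet_comm[of _ "x\<^sup>\<star>" "p\<^sup>\<star>"])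
      ultimately show ?thesis by simp
    qed
    ultimately show ?thesis by (simp add: closely_related_def)
  qed
  define B where "B = {r \<in> M. x \<sqsubseteq> r \<and> p \<notin> f r}"
  have "finite B"
  proof (rule finite_subset[OF _ finite_S])
    show "B \<subseteq> S" unfolding B_def using M_S by blast
  qed
  \<comment> \<open>\<open>y\<close> is characterised as the supremum of
    \<open>x \<squnion> p\<close> and all \<open>r\<^sup>\<star>\<close> with
    \<open>r \<in> F\<close>; leastness is what later gives
    \<open>y \<sqsubseteq> r\<close>.\<close>
  moreover have "\<exists>y\<in>P. x \<squnion> p \<sqsubseteq> y \<and> (\<forall>r\<in>F. r\<^sup>\<star> \<sqsubseteq> y) \<and>
      (\<forall>u\<in>carrier U. x \<squnion> p \<sqsubseteq> u \<longrightarrow> (\<forall>r\<in>F. r\<^sup>\<star> \<sqsubseteq> u) \<longrightarrow> y \<sqsubseteq> u) \<and>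
      (\<forall>Q. prof Q \<longrightarrow> close (x\<^sup>\<star>) Q \<longrightarrow> close (y\<^sup>\<star>) Q)" if "finite F" "F \<subseteq> B" for F
    using that
  proof induction
    case empty
    show ?case using jP close_j c by (intro bexI[of _ "x \<squnion> p"]) auto
  next
    case (insert r F)
    have "F \<subseteq> B" using insert.prems by simp
    then obtain y where y: "y \<in> P" "x \<squnion> p \<sqsubseteq> y" "\<forall>r\<in>F. r\<^sup>\<star> \<sqsubseteq> y"
      "\<And>u. \<lbrakk>u \<in> carrier U; x \<squnion> p \<sqsubseteq> u; \<forall>r\<in>F. r\<^sup>\<star> \<sqsubseteq> u\<rbrakk> \<Longrightarrow> y \<sqsubseteq> u"
      "\<And>Q. \<lbrakk>prof Q; close (x\<^sup>\<star>) Q\<rbrakk> \<Longrightarrow> close (y\<^sup>\<star>) Q"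
      using insert.IH by metis
    have r: "r \<in> M" "p \<notin> f r" using insert.prems by (auto simp: B_def)
    have rc: "r \<in> carrier U" "y \<in> carrier U" "y \<in> S" using r y pP by auto
    \<comment> \<open>Being above \<open>p\<close>, also \<open>y\<close> is missing from
      \<open>f r\<close>. So \<open>f r\<close> contains \<open>y\<^sup>\<star>\<close>, and
      closeness of \<open>r\<close> puts the next join into \<open>S\<close>.\<close>
    have "p \<sqsubseteq> y" using le_trans[OF join_right y(2)] c rc by simp
    then have "y \<notin> f r" using prof_up_notin[OF pP f(1) pP' r(2) y(1)] r by blast
    then have yr: "y\<^sup>\<star> \<in> f r" using prof_star f r rc by blast
    then have "r \<sqinter> y\<^sup>\<star> \<in> S" using closeD f r by blast
    then have yS: "y \<squnion> r\<^sup>\<star> \<in> S"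
      using rc star_meet_in_S_iff[of y "r\<^sup>\<star>"] by (simp add: meet_comm)
    have up: "u \<sqsubseteq> y \<squnion> r\<^sup>\<star>" if "u \<sqsubseteq> y" "u \<in> carrier U" for u
      using le_trans[OF that(1) join_left] that rc by simp
    have "y \<squnion> r\<^sup>\<star> \<in> P" using prof_join[OF pP y(1) M_star[OF r(1) P] yS] .
    moreover have "x \<squnion> p \<sqsubseteq> y \<squnion> r\<^sup>\<star>" using up y c by simp
    moreover have "\<forall>r'\<in>insert r F. r'\<^sup>\<star> \<sqsubseteq> y \<squnion> r\<^sup>\<star>"
    proof
      fix r' assume "r' \<in> insert r F"
      then consider "r' = r" | "r' \<in> F" by blast
      then show "r'\<^sup>\<star> \<sqsubseteq> y \<squnion> r\<^sup>\<star>"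
      proof cases
        case 1
        then show ?thesis using join_right rc by simp
      next
        case 2
        then have "r' \<in> M" using insert.prems by (auto simp: B_def)
        then show ?thesis using up[of "r'\<^sup>\<star>"] 2 y by simp
      qed
    qed
    moreover have "y \<squnion> r\<^sup>\<star> \<sqsubseteq> u" if "u \<in> carrier U" "x \<squnion> p \<sqsubseteq> u" "\<forall>r\<in>insert r F. r\<^sup>\<star> \<sqsubseteq> u" for u
      using that y(4)[of u] rc by (intro join_le) auto
    \<comment> \<open>The key fact, passing through \<open>f r\<close>.\<close>
    moreover have "close ((y \<squnion> r\<^sup>\<star>)\<^sup>\<star>) Q" if "prof Q" "close (x\<^sup>\<star>) Q" for Q
      using close_meet[OF that(1) f(1) y(5)[OF that] yr f(2)] r rc by (simp add: star_join)
    ultimately show ?case by blast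
  qed
  ultimately obtain y where y: "y \<in> P" "x \<squnion> p \<sqsubseteq> y" "\<forall>r\<in>B. r\<^sup>\<star> \<sqsubseteq> y"
      "\<And>u. \<lbrakk>u \<in> carrier U; x \<squnion> p \<sqsubseteq> u; \<forall>r\<in>B. r\<^sup>\<star> \<sqsubseteq> u\<rbrakk> \<Longrightarrow> y \<sqsubseteq> u"
      "\<And>Q. \<lbrakk>prof Q; close (x\<^sup>\<star>) Q\<rbrakk> \<Longrightarrow> close (y\<^sup>\<star>) Q" by (metis subset_refl)
  have yS: "y \<in> S" "y \<in> carrier U" using y pP by auto
  have xy: "x \<sqsubseteq> y" "p \<sqsubseteq> y"
    using le_trans[OF join_left y(2)] le_trans[OF join_right y(2)] c yS by simp_all
  have "y \<sqsubseteq> r \<or> y\<^sup>\<star> \<sqsubseteq> r" if r: "r \<in> M" for r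
  proof -
    have rc: "r \<in> carrier U" using r by simp
    have up: "y\<^sup>\<star> \<sqsubseteq> r" if "u \<sqsubseteq> y" "r\<^sup>\<star> \<sqsubseteq> u" "u \<in> carrier U" for u
      using le_trans[OF that(2,1)] that rc yS star_le[of r y] by simp
    consider "x\<^sup>\<star> \<sqsubseteq> r" | "x \<sqsubseteq> r" "p \<notin> f r" | "x \<sqsubseteq> r" "p \<in> f r"
      using x r unfolding around_def by blast
    then show ?thesis
    proof cases
      case 1
      then show ?thesis using up[of x] xy star_le[of x r] c rc by simp
    next
      case 2
      then show ?thesis using up[of "r\<^sup>\<star>"] y(3) r rc by (simp add: B_def)
    next
      case 3
      note p_r = pr[OF r 3]
      show ?thesis
      proof (cases "\<forall>s\<in>B. s\<^sup>\<star> \<sqsubseteq> r")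
        case True
        then show ?thesis using y(4)[OF rc] join_le[OF 3(1) p_r] c rc by simp
      next
        case False
        \<comment> \<open>By \<open>M_nested\<close>, \<open>s\<close> and \<open>r\<close> are
          comparable. If \<open>s \<sqsubseteq> r\<close>, then \<open>r\<^sup>\<star> \<sqsubseteq>
          s\<^sup>\<star> \<sqsubseteq> y\<close>. If \<open>r \<sqsubseteq> s\<close>, then
          \<open>p\<close> is below \<open>s\<close> but not in \<open>f s\<close>, so
          \<open>p = s\<^sup>\<star>\<close>, contrary to the choice of \<open>s\<close>.\<close>
        then obtain s where s: "s \<in> B" "\<not> s\<^sup>\<star> \<sqsubseteq> r" by blast
        then have sM: "s \<in> M" "p \<notin> f s" by (auto simp: B_def)
        have sc: "s \<in> carrier U" using sM by simp
        consider "s \<sqsubseteq> r" | "r \<sqsubseteq> s" using M_nested[OF sM(1) r] s by blast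
        then show ?thesis
        proof cases
          case 1
          then show ?thesis
            using up[of "s\<^sup>\<star>"] y(3) s(1) star_antimono[of s r] sc rc by simp
        next
          case 2
          then have "p \<sqsubseteq> s" using le_trans[OF p_r] c rc sc by blast
          then have "p = s\<^sup>\<star>"
            using prof_down[OF f(1)[OF sM(1)] close_mem[OF f(2)[OF sM(1)]] pS(1) _ sM(2)] by blast
          then show ?thesis using s(2) p_r by simp
        qed
      qed
    qed
  qed
  then have "y \<in> K" using yS unfolding around_def by blast
  moreover have "y \<noteq> x"
  proof
    assume "y = x"
    then show False using xy(2) meet_absorb[of p x] c pS by (simp add: meet_comm)
  qed
  ultimately show ?thesis using that y xy by blast
qed

section \<open>Good separations of remaining profiles and existence of candidates\<close>

lemma good_pair:
  assumes P: "P \<in> \<Q>" and Q: "Q \<in> \<Q>" and ne: "P \<noteq> Q"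
  obtains t where "t \<in> K" "close t P" "close (t\<^sup>\<star>) Q" "t \<notin> Q"
proof -
  note pP = prof_Q[OF P] and pQ = prof_Q[OF Q]
  obtain s where s: "s \<in> K" "s \<in> Q" "s \<notin> P" using separated[OF Q P] ne by blast
  \<comment> \<open>A maximal element cannot be extended, so it is close to
    \<open>Q\<close>.\<close>
  define A where "A = {t \<in> K. t \<in> Q \<and> t \<notin> P}"
  have "A \<subseteq> S" using K_S unfolding A_def by blast
  moreover have "s \<in> A" using s by (simp add: A_def)
  ultimately obtain m where m: "m \<in> A" "\<And>y. \<lbrakk>y \<in> A; m \<sqsubseteq> y\<rbrakk> \<Longrightarrow> y = m"
    by (rule S_maximal) blast
  have mA: "m \<in> K" "m \<in> Q" "m \<notin> P" using m by (auto simp: A_def)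
  have "close m Q"
  proof (rule ccontr)
    assume "\<not> close m Q"
    then obtain y where y: "y \<in> K" "y \<in> Q" "m \<sqsubseteq> y" "y \<noteq> m" using extend[OF Q mA(1,2)] by blast
    then have "y \<notin> P" using prof_up_notin[OF pQ pP mA(2,3)] by blast
    then show False using y m by (auto simp: A_def)
  qed
  \<comment> \<open>A second maximisation, now on the side of \<open>P\<close> and starting from
    \<open>m\<^sup>\<star>\<close>. Since \<open>extend\<close> preserves closeness of the inverse
    to \<open>Q\<close>, a maximal element is close on both sides.\<close>
  define B where "B = {t \<in> K. t \<in> P \<and> t \<notin> Q \<and> close (t\<^sup>\<star>) Q}"
  have mS: "m \<in> S" using mA K_S by blast
  have mP: "m\<^sup>\<star> \<in> P" using prof_star[OF pP mS mA(3)] .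
  moreover have "m\<^sup>\<star> \<notin> Q" using prof_degenerate[OF pQ mA(2)] mP mA(3) by metis
  ultimately have mB: "m\<^sup>\<star> \<in> B" using \<open>close m Q\<close> mA(1) K_star mS by (simp add: B_def)
  have "B \<subseteq> S" using K_S unfolding B_def by blast
  then obtain t where t: "t \<in> B" "\<And>y. \<lbrakk>y \<in> B; t \<sqsubseteq> y\<rbrakk> \<Longrightarrow> y = t"
    by (rule S_maximal[OF _ mB]) blast
  have tB: "t \<in> K" "t \<in> P" "t \<notin> Q" "close (t\<^sup>\<star>) Q" using t by (auto simp: B_def)
  have "close t P"
  proof (rule ccontr)
    assume "\<not> close t P"
    then obtain y where y: "y \<in> K" "y \<in> P" "t \<sqsubseteq> y" "y \<noteq> t" "close (y\<^sup>\<star>) Q"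
      using extend[OF P tB(1,2)] pQ tB(4) by metis
    then have "y \<notin> Q" using prof_up_notin[OF pP pQ tB(2,3)] by blast
    then show False using y t by (auto simp: B_def)
  qed
  then show ?thesis using that tB by blast
qed

text \<open>The descent step for \<open>exists_candidate\<close>: replacing \<open>z\<close> by
  \<open>z \<squnion> t\<close> gains no profile of \<open>\<Q>\<close> and loses \<open>R\<close>,
  and the inverse stays close to a profile, now \<open>R\<close>. The key fact applies because
  \<open>t\<^sup>\<star> \<in> Q\<close>.\<close>

lemma shrink:
  assumes z: "z \<in> K" "Q \<in> \<Q>" "close (z\<^sup>\<star>) Q"
    and t: "t \<in> K" "R \<in> \<Q>" "close (t\<^sup>\<star>) R" "t \<notin> R" "t\<^sup>\<star> \<in> Q"
    and P: "P \<in> \<Q>" "z \<in> P" "t \<in> P" and R: "z \<in> R"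
  shows "z \<squnion> t \<in> K" "close ((z \<squnion> t)\<^sup>\<star>) R" "z \<squnion> t \<in> P" "z \<squnion> t \<notin> R"
    "\<And>W. \<lbrakk>W \<in> \<Q>; z \<squnion> t \<in> W\<rbrakk> \<Longrightarrow> z \<in> W"
proof -
  note S = K_S[OF z(1)] K_S[OF t(1)]
  have c: "z \<in> carrier U" "t \<in> carrier U" using S by auto
  have j: "t \<squnion> z = z \<squnion> t" by (simp add: join_comm)
  have jS: "z \<squnion> t \<in> S" and jc: "close ((z \<squnion> t)\<^sup>\<star>) R"
    using close_star_join[OF prof_Q[OF t(2)] prof_Q[OF z(2)] t(3,5) z(3) S(2,1)] by (simp_all add: j)
  show "close ((z \<squnion> t)\<^sup>\<star>) R" by fact
  show "z \<squnion> t \<in> K" using K_join[OF z(1) t(1) jS] .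
  show jP: "z \<squnion> t \<in> P" using prof_join[OF prof_Q[OF P(1)] P(2,3) jS] .
  show "z \<squnion> t \<notin> R"
    using prof_up_notin[OF prof_Q[OF P(1)] prof_Q[OF t(2)] P(3) t(4) jP] join_right c by blast
  show "z \<in> W" if W: "W \<in> \<Q>" "z \<squnion> t \<in> W" for W
    using prof_transfer[OF prof_Q[OF P(1)] prof_Q[OF W(1)] jP W(2) P(2)] join_left c by blast
qed

lemma finite_Q: "finite \<Q>"
proof (rule finite_subset)
  show "\<Q> \<subseteq> Pow S" using prof_Q prof_S by blast
qed (use finite_S in simp)

lemma exists_candidate:
  assumes "P0 \<in> \<Q>" "Q0 \<in> \<Q>" "P0 \<noteq> Q0"
  obtains P where "P \<in> \<Q>" "candidates U S M \<Q> P \<noteq> {}"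
proof -
  define T where "T z = {P \<in> \<Q>. z \<in> P}" for z
  \<comment> \<open>Candidates up to uniqueness of the profile containing them; minimising the
    number of those profiles will restore uniqueness.\<close>
  define D where "D = {z \<in> K. \<exists>Q\<in>\<Q>. z \<notin> Q \<and> close (z\<^sup>\<star>) Q \<and> T z \<noteq> {}}"
  obtain t0 where "t0 \<in> K" "close t0 P0" "close (t0\<^sup>\<star>) Q0" "t0 \<notin> Q0"
    using good_pair assms by metis
  then have "t0 \<in> D" using assms close_mem by (auto simp: D_def T_def)
  define z where "z = arg_min (\<lambda>z. card (T z)) (\<lambda>z. z \<in> D)"
  have zD: "z \<in> D" unfolding z_def by (rule arg_min_natI) fact
  have min: "card (T z) \<le> card (T w)" if "w \<in> D" for w
    unfolding z_def by (rule arg_min_nat_le) fact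
  have T_less: "card (T w) < card (T z)" if "R \<in> \<Q>" "z \<in> R" "w \<notin> R" "\<And>W. \<lbrakk>W \<in> \<Q>; w \<in> W\<rbrakk> \<Longrightarrow> z \<in> W" for w R
  proof (rule psubset_card_mono)
    show "finite (T z)" using finite_Q by (simp add: T_def)
    show "T w \<subset> T z" using that by (auto simp: T_def)
  qed
  obtain P Q where PQ: "Q \<in> \<Q>" "z \<notin> Q" "close (z\<^sup>\<star>) Q" "P \<in> \<Q>" "z \<in> P" and zK: "z \<in> K"
    using zD by (auto simp: D_def T_def)
  have "z \<notin> R" if R: "R \<in> \<Q>" "R \<noteq> P" for R
  proof
    assume zR: "z \<in> R"
    \<comment> \<open>A good separation between \<open>P\<close> and \<open>R\<close> allows a
      descent. If \<open>t \<notin> Q\<close>, joining with \<open>t\<close> loses \<open>R\<close>.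
      Otherwise \<open>t\<^sup>\<star>\<close> is used with \<open>P\<close> and \<open>R\<close>
      exchanged, and \<open>P\<close> is lost.\<close>
    obtain t where t: "t \<in> K" "close t P" "close (t\<^sup>\<star>) R" "t \<notin> R"
      using good_pair[OF PQ(4) R(1)] R by metis
    have tS: "t \<in> S" "t \<in> carrier U" using K_S t by auto
    have "\<exists>w\<in>D. card (T w) < card (T z)"
    proof (cases "t \<in> Q")
      case False
      then have "t\<^sup>\<star> \<in> Q" using prof_star prof_Q PQ tS by blast
      note sh = shrink[OF zK PQ(1,3) t(1) R(1) t(3,4) this PQ(4,5) close_mem[OF t(2)] zR]
      have "z \<squnion> t \<in> D" using sh R PQ by (auto simp: D_def T_def)
      then show ?thesis using T_less[OF R(1) zR sh(4)] sh(5) by blast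
    next
      case True
      have "t\<^sup>\<star> \<notin> P"
        using prof_degenerate[OF prof_Q[OF PQ(4)] close_mem[OF t(2)]] t close_mem by metis
      note sh = shrink[OF zK PQ(1,3) K_star[OF t(1)] PQ(4) _ this _ R(1) zR close_mem[OF t(3)] PQ(5)]
      have sh': "z \<squnion> t\<^sup>\<star> \<in> K" "close ((z \<squnion> t\<^sup>\<star>)\<^sup>\<star>) P" "z \<squnion> t\<^sup>\<star> \<in> R" "z \<squnion> t\<^sup>\<star> \<notin> P"
        "\<And>W. \<lbrakk>W \<in> \<Q>; z \<squnion> t\<^sup>\<star> \<in> W\<rbrakk> \<Longrightarrow> z \<in> W"
        using sh t(2) True tS by simp_all
      have "z \<squnion> t\<^sup>\<star> \<in> D" using sh' R PQ by (auto simp: D_def T_def)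
      then show ?thesis using T_less[OF PQ(4,5) sh'(4)] sh'(5) by blast
    qed
    then show False using min by fastforce
  qed
  moreover have "Q \<noteq> P" using PQ by blast
  ultimately have "z \<in> candidates U S M \<Q> P" using PQ zK unfolding candidates_def by blast
  then show ?thesis using that PQ by blast
qed

section \<open>Greatest candidates\<close>

lemma candidateD:
  assumes "x \<in> candidates U S M \<Q> P"
  shows "x \<in> K" "x \<in> S" "x \<in> carrier U" "x \<in> P" "\<And>R. \<lbrakk>R \<in> \<Q>; R \<noteq> P\<rbrakk> \<Longrightarrow> x \<notin> R"
    "\<exists>R\<in>\<Q>. R \<noteq> P \<and> close (x\<^sup>\<star>) R"
  using assms K_S[of x] S_carrier[of x] unfolding candidates_def by blast+

text \<open>Going up inside \<open>P\<close> brings in no other profile by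
  \<open>prof_up_notin\<close>, so only the closeness of the inverse has to be supplied.\<close>

lemma candidateI:
  assumes P: "P \<in> \<Q>" and x: "x \<in> candidates U S M \<Q> P"
    and y: "y \<in> K" "y \<in> P" "x \<sqsubseteq> y" and R: "R \<in> \<Q>" "R \<noteq> P" "close (y\<^sup>\<star>) R"
  shows "y \<in> candidates U S M \<Q> P"
proof -
  have "y \<notin> Q" if "Q \<in> \<Q>" "Q \<noteq> P" for Q
    using prof_up_notin[OF prof_Q[OF P] prof_Q[OF that(1)] candidateD(4,5)[OF x] y(2,3)] that by blast
  then show ?thesis using y R unfolding candidates_def by blast
qed

lemma candidate_star:
  assumes "x \<in> candidates U S M \<Q> P" "R \<in> \<Q>" "R \<noteq> P"
  shows "x\<^sup>\<star> \<in> R"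
  using candidateD(2,5)[OF assms(1)] assms prof_star prof_Q by blast

text \<open>\<open>x\<^sup>\<star>\<close> is close to \<open>Q\<close> and lies in
  \<open>R\<close>, to which \<open>y\<^sup>\<star>\<close> is close, so the key fact
  applies.\<close>

lemma candidates_join:
  assumes P: "P \<in> \<Q>" and x: "x \<in> candidates U S M \<Q> P" and y: "y \<in> candidates U S M \<Q> P"
  shows "x \<squnion> y \<in> candidates U S M \<Q> P"
proof -
  obtain Q R where Q: "Q \<in> \<Q>" "Q \<noteq> P" "close (x\<^sup>\<star>) Q" and R: "R \<in> \<Q>" "R \<noteq> P" "close (y\<^sup>\<star>) R"
    using candidateD(6)[OF x] candidateD(6)[OF y] by blast
  note j = close_star_join[OF prof_Q[OF Q(1)] prof_Q[OF R(1)] Q(3) candidate_star[OF x R(1,2)] R(3)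
      candidateD(2)[OF x] candidateD(2)[OF y]]
  show ?thesis
    using candidateI[OF P x K_join[OF candidateD(1)[OF x] candidateD(1)[OF y] j(1)] _ _ Q(1,2) j(2)]
      prof_join[OF prof_Q[OF P] candidateD(4)[OF x] candidateD(4)[OF y] j(1)]
      join_left candidateD(3)[OF x] candidateD(3)[OF y] by blast
qed

lemma topsD: "x \<in> tops U S M \<Q> P \<Longrightarrow> x \<in> candidates U S M \<Q> P"
  "\<lbrakk>x \<in> tops U S M \<Q> P; y \<in> candidates U S M \<Q> P\<rbrakk> \<Longrightarrow> y \<sqsubseteq> x"
  by (auto simp: tops_def)

text \<open>Finiteness gives a maximal candidate, and closure under joins makes it greatest.\<close>

lemma tops_nonempty:
  assumes P: "P \<in> \<Q>" and "x \<in> candidates U S M \<Q> P"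
  shows "tops U S M \<Q> P \<noteq> {}"
proof -
  let ?C = "candidates U S M \<Q> P"
  have "?C \<subseteq> S" using candidateD(2) by blast
  then obtain m where m: "m \<in> ?C" "\<And>y. \<lbrakk>y \<in> ?C; m \<sqsubseteq> y\<rbrakk> \<Longrightarrow> y = m"
    by (rule S_maximal[OF _ assms(2)]) blast
  have "y \<sqsubseteq> m" if y: "y \<in> ?C" for y
  proof -
    note c = candidateD(3)[OF m(1)] candidateD(3)[OF y]
    have "m \<squnion> y = m" using m(2) candidates_join[OF P m(1) y] join_left c by blast
    then show ?thesis using join_right[OF c] by simp
  qed
  then show ?thesis using m by (auto simp: tops_def)
qed

text \<open>Otherwise \<open>extend\<close> would yield a strictly larger candidate.\<close>

lemma tops_close:
  assumes P: "P \<in> \<Q>" and x: "x \<in> tops U S M \<Q> P"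
  shows "close x P"
proof (rule ccontr)
  assume n: "\<not> close x P"
  note xc = topsD(1)[OF x]
  obtain R where R: "R \<in> \<Q>" "R \<noteq> P" "close (x\<^sup>\<star>) R" using candidateD(6)[OF xc] by blast
  obtain y where y: "y \<in> K" "y \<in> P" "x \<sqsubseteq> y" "y \<noteq> x" "close (y\<^sup>\<star>) R"
    using extend[OF P candidateD(1,4)[OF xc] n] prof_Q[OF R(1)] R(3) by metis
  have "y \<sqsubseteq> x" using topsD(2)[OF x candidateI[OF P xc y(1-3) R(1,2) y(5)]] .
  then show False using y le_antisym[of x y] candidateD(3)[OF xc] K_S by simp
qed

lemma tops_unique:
  assumes "x \<in> tops U S M \<Q> P" "y \<in> tops U S M \<Q> P"
  shows "x = y"
  using le_antisym[of x y] assms candidateD(3)[OF topsD(1)] topsD by blast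

text \<open>By the key fact \<open>x\<^sup>\<star> \<sqinter> y\<close>, the inverse of
  \<open>x \<squnion> y\<^sup>\<star>\<close>, is close to \<open>R\<close>. So this join is again a
  candidate for \<open>P\<close> and lies below the greatest one, \<open>x\<close>.\<close>

lemma tops_nested:
  assumes P: "P \<in> \<Q>" and Q: "Q \<in> \<Q>" and ne: "P \<noteq> Q"
    and x: "x \<in> tops U S M \<Q> P" and y: "y \<in> tops U S M \<Q> Q"
  shows "x\<^sup>\<star> \<sqsubseteq> y"
proof -
  note xc = topsD(1)[OF x] and yc = topsD(1)[OF y]
  note c = candidateD(3)[OF xc] candidateD(3)[OF yc]
  obtain R where R: "R \<in> \<Q>" "R \<noteq> P" "close (x\<^sup>\<star>) R" using candidateD(6)[OF xc] by blast
  have xQ: "x\<^sup>\<star> \<in> Q" and yP: "y\<^sup>\<star> \<in> P"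
    using candidate_star[OF xc Q] candidate_star[OF yc P] ne by auto
  have "close (x\<^sup>\<star> \<sqinter> y) R"
    using close_meet[OF prof_Q[OF R(1)] prof_Q[OF Q] R(3) xQ tops_close[OF Q y]] .
  then have cl: "close ((x \<squnion> y\<^sup>\<star>)\<^sup>\<star>) R" using c by (simp add: star_join)
  have jS: "x \<squnion> y\<^sup>\<star> \<in> S"
    using prof_S[OF prof_Q[OF R(1)] close_mem[OF cl]] c by (simp add: star_in_S_iff)
  have "x \<squnion> y\<^sup>\<star> \<in> candidates U S M \<Q> P"
    using candidateI[OF P xc K_join[OF candidateD(1)[OF xc] K_star[OF candidateD(1)[OF yc]] jS] _ _ R(1,2) cl]
      prof_join[OF prof_Q[OF P] candidateD(4)[OF xc] yP jS] join_left[of x "y\<^sup>\<star>"] c by simp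
  then have "x \<squnion> y\<^sup>\<star> \<sqsubseteq> x" using topsD(2)[OF x] by blast
  then have "y\<^sup>\<star> \<sqsubseteq> x" using le_trans[OF join_right[of x "y\<^sup>\<star>"]] c by simp
  then show ?thesis using star_le[of y x] c by simp
qed

section \<open>Passage to the next stage\<close>

abbreviation "new \<equiv> new_separations U S M \<Q>"
abbreviation "rest \<equiv> remaining U S M \<Q>"

lemma newE:
  assumes "d \<in> new"
  obtains P where "P \<in> \<Q>" "d \<in> tops U S M \<Q> P"
  using assms by (auto simp: new_separations_def)

lemma new_K: "d \<in> new \<Longrightarrow> d \<in> K"
  using candidateD(1)[OF topsD(1)] newE by metis

lemma new_notin:
  assumes "d \<in> new" "Q \<in> rest"
  shows "d \<notin> Q"
  using newE[OF assms(1)] candidateD(5)[OF topsD(1)] assms(2) unfolding remaining_def by blast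

lemma new_nested:
  assumes "d \<in> new" "e \<in> new" "d \<noteq> e"
  shows "d\<^sup>\<star> \<sqsubseteq> e"
  using newE[OF assms(1)] newE[OF assms(2)] assms(3) tops_nested tops_unique by metis

text \<open>Closeness of \<open>d\<close> puts the meet into \<open>P0\<close>, from where it
  transfers to \<open>P\<close> below \<open>s\<close>. As \<open>Q\<close> contains
  \<open>s\<^sup>\<star>\<close> and \<open>d\<^sup>\<star>\<close>, the profile axiom bars the
  inverse of their join.\<close>

lemma separated_by_one:
  assumes d: "d \<in> new" and P: "P \<in> rest" and Q: "Q \<in> rest" and s: "s \<in> K" "s \<in> P" "s \<notin> Q"
    and D: "P0 \<in> \<Q>" "d \<in> tops U S M \<Q> P0" "s \<in> P0"
  shows "s \<sqinter> d \<in> K" "s \<sqinter> d \<in> P" "s \<sqinter> d \<notin> Q"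
proof -
  have PQ: "P \<in> \<Q>" "Q \<in> \<Q>" using P Q by (auto simp: remaining_def)
  note pr = prof_Q[OF PQ(1)] prof_Q[OF PQ(2)] prof_Q[OF D(1)]
  note cl = tops_close[OF D(1,2)]
  have S: "s \<in> S" "d \<in> S" using K_S new_K d s by auto
  have c: "s \<in> carrier U" "d \<in> carrier U" using S by auto
  have m0: "s \<sqinter> d \<in> P0" using close_meet_mem[OF pr(3) cl D(3)] by (simp add: meet_comm)
  have mS: "s \<sqinter> d \<in> S" using prof_S[OF pr(3) m0] .
  show "s \<sqinter> d \<in> K" using K_meet[OF s(1) new_K[OF d] mS] .
  show "s \<sqinter> d \<in> P" using prof_transfer[OF pr(3,1) D(3) s(2) m0] meet_left c by blast
  have "s\<^sup>\<star> \<in> Q" "d\<^sup>\<star> \<in> Q" using prof_star[OF pr(2)] S s(3) new_notin[OF d Q] by auto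
  then have "(s\<^sup>\<star> \<squnion> d\<^sup>\<star>)\<^sup>\<star> \<notin> Q" using pr(2) unfolding profile_def by blast
  then show "s \<sqinter> d \<notin> Q" using c by (simp add: star_join)
qed

text \<open>A separating \<open>s\<close> is uncrossed with the new separations one by one. Meeting
  with \<open>d\<close> keeps the relations already reached, since
  \<open>d\<^sup>\<star> \<sqsubseteq> e\<close> for every other new \<open>e\<close>.\<close>

lemma separated_new:
  assumes P: "P \<in> rest" and Q: "Q \<in> rest" and ne: "P \<noteq> Q" and F: "finite F" "F \<subseteq> new"
  shows "\<exists>s\<in>K. s \<in> P \<and> s \<notin> Q \<and> (\<forall>d\<in>F. s \<sqsubseteq> d \<or> s\<^sup>\<star> \<sqsubseteq> d)"
  using F
proof induction
  case empty
  then show ?case using separated[of P Q] P Q ne by (auto simp: remaining_def)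
next
  case (insert d F)
  then obtain s where s: "s \<in> K" "s \<in> P" "s \<notin> Q" "\<forall>d\<in>F. s \<sqsubseteq> d \<or> s\<^sup>\<star> \<sqsubseteq> d" by auto
  have d: "d \<in> new" "\<And>e. e \<in> F \<Longrightarrow> d\<^sup>\<star> \<sqsubseteq> e"
    using insert.prems insert.hyps(2) by simp (metis insert.prems insert.hyps(2) insert_subset new_nested subsetD)
  obtain P0 where D: "P0 \<in> \<Q>" "d \<in> tops U S M \<Q> P0" using newE[OF d(1)] .
  have c: "s \<in> carrier U" "d \<in> carrier U" using K_S new_K d(1) s by auto
  have nest: "w \<sqinter> d \<sqsubseteq> e \<or> (w \<sqinter> d)\<^sup>\<star> \<sqsubseteq> e"
    if w: "w \<in> carrier U" "w \<sqsubseteq> e \<or> w\<^sup>\<star> \<sqsubseteq> e" and e: "e \<in> F" for w e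
  proof -
    have ec: "e \<in> carrier U" using K_S new_K insert.prems e by auto
    from w(2) show ?thesis
    proof
      assume "w \<sqsubseteq> e"
      then show ?thesis using le_trans[OF meet_left[of w d]] w c ec by simp
    next
      assume "w\<^sup>\<star> \<sqsubseteq> e"
      then show ?thesis using d(2)[OF e] join_le[of "w\<^sup>\<star>" e "d\<^sup>\<star>"] w c ec by (simp add: star_meet)
    qed
  qed
  show ?case
  proof (cases "s \<in> P0")
    case True
    note one = separated_by_one[OF d(1) P Q s(1-3) D True]
    show ?thesis
      using one nest[of s] s(4) c meet_right[of s d] by (intro bexI[of _ "s \<sqinter> d"]) auto
  next
    case False
    have PQ: "P \<in> \<Q>" "Q \<in> \<Q>" using P Q by (auto simp: remaining_def)
    have sS: "s \<in> S" using s K_S by blast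
    have st: "s\<^sup>\<star> \<in> Q" "s\<^sup>\<star> \<in> P0" using prof_star prof_Q PQ D(1) sS s(3) False by blast+
    have "s\<^sup>\<star> \<notin> P" using prof_degenerate[OF prof_Q[OF PQ(1)] s(2)] s(3) st(1) by metis
    \<comment> \<open>Here \<open>P0\<close> contains the other orientation, so
      \<open>s\<^sup>\<star>\<close> is uncrossed with \<open>P\<close> and \<open>Q\<close>
      exchanged, and the result is inverted.\<close>
    note one = separated_by_one[OF d(1) Q P K_star[OF s(1)] st(1) this D st(2)]
    have mc: "s\<^sup>\<star> \<sqinter> d \<in> carrier U" using c by simp
    have "(s\<^sup>\<star> \<sqinter> d)\<^sup>\<star> \<in> P"
      using prof_star[OF prof_Q[OF PQ(1)] K_S[OF one(1)] one(3)] .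
    moreover from this have "(s\<^sup>\<star> \<sqinter> d)\<^sup>\<star> \<notin> Q"
      using prof_degenerate[OF prof_Q[OF PQ(2)] one(2)] one(3) by metis
    moreover have "\<forall>e\<in>F. s\<^sup>\<star> \<sqinter> d \<sqsubseteq> e \<or> (s\<^sup>\<star> \<sqinter> d)\<^sup>\<star> \<sqsubseteq> e"
      using nest[of "s\<^sup>\<star>"] s(4) c by (metis star_closed star_star)
    ultimately show ?thesis
      using K_star[OF one(1)] c mc meet_right[of "s\<^sup>\<star>" d]
      by (intro bexI[of _ "(s\<^sup>\<star> \<sqinter> d)\<^sup>\<star>"]) auto
  qed
qed

lemma next_stage: "stage U S \<P> (M \<union> new) rest"
proof unfold_locales
  show "rest \<subseteq> \<P>" using subset by (auto simp: remaining_def)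
next
  fix r assume "r \<in> M \<union> new"
  then show "\<exists>P\<in>\<P>. \<exists>P'\<in>\<P>. P \<noteq> P' \<and> close r P \<and> close (r\<^sup>\<star>) P'"
  proof
    assume "r \<in> new"
    then obtain P where P: "P \<in> \<Q>" "r \<in> tops U S M \<Q> P" by (rule newE)
    then show ?thesis using tops_close[OF P] candidateD(6)[OF topsD(1)[OF P(2)]] subset by blast
  qed (rule good_M)
next
  fix r P assume "r \<in> M \<union> new" "P \<in> rest"
  moreover from this have "P \<in> \<Q>" by (simp add: remaining_def)
  ultimately show "r \<notin> P" using M_notin new_notin by blast
next
  fix r s assume rs: "r \<in> M \<union> new" "s \<in> M \<union> new"
  have c: "r \<in> carrier U" "s \<in> carrier U" using rs M_S[THEN S_carrier] new_K[THEN K_S, THEN S_carrier] by blast+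
  have *: "a \<sqsubseteq> b \<or> a\<^sup>\<star> \<sqsubseteq> b" if "a \<in> new" "b \<in> M" for a b
    using new_K[OF that(1)] that(2) unfolding around_def by blast
  consider "r \<in> M" "s \<in> M" | "r \<in> new" "s \<in> M" | "s \<in> new" "r \<in> M" | "r \<in> new" "s \<in> new"
    using rs by blast
  then show "r \<sqsubseteq> s \<or> s \<sqsubseteq> r \<or> r\<^sup>\<star> \<sqsubseteq> s"
  proof cases
    case 3
    then show ?thesis using *[of s r] star_le[of s r] c by blast
  next
    case 4
    then show ?thesis using new_nested[of r s] c by (cases "r = s") auto
  qed (use M_nested[of r s] *[of r s] in blast)+
next
  fix P Q assume PQ: "P \<in> rest" "Q \<in> rest" "P \<noteq> Q"
  have "new \<subseteq> S" using new_K K_S by blast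
  then have "finite new" using finite_S finite_subset by blast
  then obtain s where "s \<in> K" "s \<in> P" "s \<notin> Q" "\<forall>d\<in>new. s \<sqsubseteq> d \<or> s\<^sup>\<star> \<sqsubseteq> d"
    using separated_new[OF PQ] by blast
  then show "\<exists>s\<in>around U S (M \<union> new). s \<in> P \<and> s \<notin> Q"
    unfolding around_def by blast
next
  fix P Q assume PQ: "P \<in> \<P>" "Q \<in> \<P>" "P \<noteq> Q" and n: "\<not> (P \<in> rest \<and> Q \<in> rest)"
  \<comment> \<open>A profile \<open>A\<close> that has just been split off contains its greatest
    candidate, which no other profile of \<open>\<Q>\<close> contains.\<close>
  have *: "\<exists>r\<in>new. r \<in> A \<and> r \<notin> B" if AB: "A \<in> \<Q>" "B \<in> \<Q>" "A \<noteq> B" "A \<notin> rest" for A B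
  proof -
    obtain d where "d \<in> tops U S M \<Q> A" using AB by (auto simp: remaining_def)
    then show ?thesis using candidateD(4,5)[OF topsD(1)] AB unfolding new_separations_def by blast
  qed
  show "\<exists>r\<in>M \<union> new. (r \<in> P) \<noteq> (r \<in> Q)"
  proof (cases "P \<in> \<Q> \<and> Q \<in> \<Q>")
    case True
    then show ?thesis using *[of P Q] *[of Q P] PQ n by blast
  next
    case False
    then show ?thesis using settled[OF PQ] by blast
  qed
qed (rule profiles)

lemma rest_smaller:
  assumes "card \<Q> > 1"
  shows "card rest < card \<Q>"
proof -
  obtain P Q where "P \<in> \<Q>" "Q \<in> \<Q>" "P \<noteq> Q"
    using assms finite_Q by (metis card_le_Suc0_iff_eq One_nat_def not_le)
  then obtain R where R: "R \<in> \<Q>" "candidates U S M \<Q> R \<noteq> {}" using exists_candidate by metis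
  then have "tops U S M \<Q> R \<noteq> {}" using tops_nonempty by blast
  then have "rest \<subset> \<Q>" using R unfolding remaining_def by blast
  then show ?thesis using finite_Q psubset_card_mono by blast
qed

end

section \<open>The choice function\<close>

primrec run :: "'a sepsys \<Rightarrow> 'a set \<Rightarrow> 'a set set \<Rightarrow> nat \<Rightarrow> 'a set \<times> 'a set set" where
  "run U S \<P> 0 = ({}, \<P>)"
| "run U S \<P> (Suc n) =
     (case run U S \<P> n of (M, \<Q>) \<Rightarrow> (M \<union> new_separations U S M \<Q>, remaining U S M \<Q>))"

text \<open>The number of rounds is fixed in advance: each round discards a profile while two are
  left, and surplus rounds change nothing, since a lone profile has no candidates.\<close>

definition nested_choice :: "'a sep_choice" where
  "nested_choice U S \<P> = unor U ` fst (run U S \<P> (card \<P>))"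

lemma submodular_systemI:
  assumes "submodular U S" "finite S"
  shows "submodular_system U S"
proof -
  interpret universe U using assms by (simp add: submodular_def)
  interpret S: separation_system "U\<lparr>carrier := S\<rparr>" using assms by (simp add: submodular_def)
  show ?thesis
    using assms S.star_closed by unfold_locales (auto simp: submodular_def)
qed

section \<open>Correctness of the iteration\<close>

context submodular_system
begin

text \<open>Provides \<open>separated\<close> for the initial stage, where all of \<open>S\<close>
  is admissible. An \<open>x\<close> in \<open>Q\<close> but not in \<open>P\<close> would have its
  inverse in \<open>P\<close>, hence in \<open>Q\<close>, and be degenerate; but degenerate
  separations lie in every profile.\<close>

lemma profile_eqI:
  assumes "prof P" "prof Q" "P \<subseteq> Q"
  shows "P = Q"
proof (rule ccontr)
  assume "P \<noteq> Q"
  then obtain x where x: "x \<in> Q" "x \<notin> P" using assms(3) by blast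
  then have xS: "x \<in> S" using prof_S[OF assms(2)] by blast
  then have "x\<^sup>\<star> \<in> Q" using prof_star[OF assms(1) _ x(2)] assms(3) by blast
  then show False
    using prof_degenerate[OF assms(2) x(1)] prof_degenerate_mem[OF assms(1) xS] x(2) by blast
qed

lemma stage_run:
  assumes "\<And>P. P \<in> \<P> \<Longrightarrow> prof P"
  shows "stage U S \<P> (fst (run U S \<P> n)) (snd (run U S \<P> n))"
proof (induction n)
  case 0
  have "\<exists>s\<in>around U S {}. s \<in> P \<and> s \<notin> Q" if "P \<in> \<P>" "Q \<in> \<P>" "P \<noteq> Q" for P Q
    using profile_eqI[of P Q] that assms prof_S[of P] by (auto simp: around_def)
  then show ?case
    using assms by unfold_locales auto
next
  case (Suc n)
  then show ?case using stage.next_stage by (auto simp: case_prod_beta)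
qed

lemma card_run:
  assumes "\<And>P. P \<in> \<P> \<Longrightarrow> prof P"
  shows "card (snd (run U S \<P> n)) \<le> max 1 (card \<P> - n)"
proof (induction n)
  case 0
  then show ?case by simp
next
  case (Suc n)
  interpret stage U S \<P> "fst (run U S \<P> n)" "snd (run U S \<P> n)"
    using stage_run assms by blast
  have e: "snd (run U S \<P> (Suc n)) = rest" by (simp add: case_prod_beta)
  have "card rest \<le> card (snd (run U S \<P> n))"
    using finite_Q by (intro card_mono) (auto simp: remaining_def)
  then show ?case using rest_smaller Suc unfolding e by linarith
qed

lemma nested_choice_good:
  assumes "\<And>P. P \<in> \<P> \<Longrightarrow> prof P"
  shows "nested_choice U S \<P> \<subseteq> unoriented U S" "nested_set U (nested_choice U S \<P>)"
    "distinguishes U (nested_choice U S \<P>) \<P>" "s \<in> nested_choice U S \<P> \<Longrightarrow> good U S \<P> s"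
proof -
  define M \<Q> where "M = fst (run U S \<P> (card \<P>))" and "\<Q> = snd (run U S \<P> (card \<P>))"
  have N: "nested_choice U S \<P> = unor U ` M" by (simp add: nested_choice_def M_def)
  interpret stage U S \<P> M \<Q> using stage_run assms by (simp add: M_def \<Q>_def)
  show "nested_choice U S \<P> \<subseteq> unoriented U S"
    unfolding N unoriented_def using M_S by blast
  show "nested_set U (nested_choice U S \<P>)"
    unfolding N nested_set_def nested_def unor_def using M_nested by blast
  show "good U S \<P> s" if s: "s \<in> nested_choice U S \<P>"
  proof -
    obtain r where r: "r \<in> M" "s = unor U r" using s by (auto simp: N)
    then show ?thesis
      using good_M[OF r(1)] M_S[OF r(1)] unfolding good_def unoriented_def by blast
  qed
  \<comment> \<open>With at most one profile left, \<open>settled\<close> covers every pair of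
    distinct profiles.\<close>
  have "card \<Q> \<le> 1" using card_run[of \<P> "card \<P>"] assms by (simp add: \<Q>_def)
  then have one: "P = Q" if "P \<in> \<Q>" "Q \<in> \<Q>" for P Q
    using that finite_Q by (metis card_le_Suc0_iff_eq One_nat_def)
  show "distinguishes U (nested_choice U S \<P>) \<P>"
    unfolding distinguishes_def
  proof (intro ballI impI)
    fix P Q assume PQ: "P \<in> \<P>" "Q \<in> \<P>" "P \<noteq> Q"
    then obtain r where r: "r \<in> M" "(r \<in> P) \<noteq> (r \<in> Q)" using settled[of P Q] one by blast
    \<comment> \<open>A degenerate \<open>r\<close> would lie in both profiles.\<close>
    have "r\<^sup>\<star> \<noteq> r"
      using prof_degenerate_mem[OF assms _] M_S[OF r(1)] PQ r(2) by blast
    then have "\<forall>x\<in>unor U r. \<not> degenerate U x"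
      using M_S[OF r(1)] by (auto simp: unor_def degenerate_def)
    moreover have "unor U r \<inter> P \<noteq> unor U r \<inter> Q" using r(2) by (auto simp: unor_def)
    ultimately show "\<exists>s\<in>nested_choice U S \<P>. (\<forall>x\<in>s. \<not> degenerate U x) \<and> s \<inter> P \<noteq> s \<inter> Q"
      using r(1) unfolding N by blast
  qed
qed

end

lemma chooses_good_nested_sets_nested_choice: "chooses_good_nested_sets nested_choice"
  unfolding chooses_good_nested_sets_def
  using submodular_system.nested_choice_good[OF submodular_systemI] by metis

section \<open>Invariance under isomorphisms\<close>

locale system_iso =
  A: submodular_system U S + B: submodular_system U' S'
  for U :: "'a sepsys" and S and U' :: "'b sepsys" and S' +
  fixes \<phi>
  assumes inj: "inj_on \<phi> S" and image: "\<phi> ` S = S'"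
    and le_iff: "\<lbrakk>x \<in> S; y \<in> S\<rbrakk> \<Longrightarrow> \<phi> x \<sqsubseteq>\<^bsub>U'\<^esub> \<phi> y \<longleftrightarrow> x \<sqsubseteq>\<^bsub>U\<^esub> y"
    and star_eq: "x \<in> S \<Longrightarrow> star U' (\<phi> x) = \<phi> (star U x)"
    and join_iff: "\<lbrakk>x \<in> S; y \<in> S\<rbrakk> \<Longrightarrow> \<phi> x \<squnion>\<^bsub>U'\<^esub> \<phi> y \<in> S' \<longleftrightarrow> x \<squnion>\<^bsub>U\<^esub> y \<in> S"
begin

lemma in_S': "x \<in> S \<Longrightarrow> \<phi> x \<in> S'"
  using image by blast

text \<open>The assumption concerns suprema; De Morgan carries it over to infima, whose membership
  in \<open>S\<close> is all that \<open>closely_related\<close> takes from the universe.\<close>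

lemma meet_iff:
  assumes "x \<in> S" "y \<in> S"
  shows "\<phi> x \<sqinter>\<^bsub>U'\<^esub> \<phi> y \<in> S' \<longleftrightarrow> x \<sqinter>\<^bsub>U\<^esub> y \<in> S"
proof -
  have "\<phi> x \<sqinter>\<^bsub>U'\<^esub> \<phi> y \<in> S' \<longleftrightarrow> \<phi> (star U x) \<squnion>\<^bsub>U'\<^esub> \<phi> (star U y) \<in> S'"
    using B.star_meet_in_S_iff[of "star U' (\<phi> x)" "star U' (\<phi> y)"] in_S' assms
    by (simp add: star_eq)
  also have "\<dots> \<longleftrightarrow> x \<sqinter>\<^bsub>U\<^esub> y \<in> S"
    using A.star_meet_in_S_iff[of "star U x" "star U y"] assms by (simp add: join_iff)
  finally show ?thesis .
qed

lemma mem_image_iff: "\<lbrakk>x \<in> S; P \<subseteq> S\<rbrakk> \<Longrightarrow> \<phi> x \<in> \<phi> ` P \<longleftrightarrow> x \<in> P"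
  using inj_on_image_mem_iff[OF inj] .

lemma image_eq: "\<lbrakk>P \<subseteq> S; Q \<subseteq> S\<rbrakk> \<Longrightarrow> \<phi> ` P = \<phi> ` Q \<longleftrightarrow> P = Q"
  using inj_on_image_eq_iff[OF inj] .

lemma closely_related_image:
  assumes "x \<in> S" "P \<subseteq> S"
  shows "closely_related U' S' (\<phi> x) (\<phi> ` P) \<longleftrightarrow> closely_related U S x P"
proof -
  have "(\<forall>r\<in>P. \<phi> x \<sqinter>\<^bsub>U'\<^esub> \<phi> r \<in> S') \<longleftrightarrow> (\<forall>r\<in>P. x \<sqinter>\<^bsub>U\<^esub> r \<in> S)"
    using meet_iff[OF assms(1)] assms(2) by blast
  then show ?thesis by (simp add: closely_related_def mem_image_iff assms)
qed

lemma around_image: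
  assumes "M \<subseteq> S"
  shows "around U' S' (\<phi> ` M) = \<phi> ` around U S M"
proof -
  have "\<phi> x \<in> around U' S' (\<phi> ` M) \<longleftrightarrow> x \<in> around U S M" if "x \<in> S" for x
  proof -
    have "(\<phi> x \<sqsubseteq>\<^bsub>U'\<^esub> \<phi> r \<or> star U' (\<phi> x) \<sqsubseteq>\<^bsub>U'\<^esub> \<phi> r) \<longleftrightarrow> (x \<sqsubseteq>\<^bsub>U\<^esub> r \<or> star U x \<sqsubseteq>\<^bsub>U\<^esub> r)"
      if "r \<in> M" for r
      using that \<open>x \<in> S\<close> assms le_iff[of x r] le_iff[of "star U x" r] by (simp add: star_eq subset_iff)
    then show ?thesis using that in_S' unfolding around_def by blast
  qed
  moreover have "around U S M \<subseteq> S" "around U' S' (\<phi> ` M) \<subseteq> \<phi> ` S"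
    unfolding around_def image by blast+
  ultimately show ?thesis by blast
qed

text \<open>Injectivity on \<open>S\<close> keeps distinct profiles distinct, as the condition
  \<open>R \<noteq> P\<close> requires.\<close>

lemma candidates_image:
  assumes M: "M \<subseteq> S" and Q: "\<And>R. R \<in> \<Q> \<Longrightarrow> R \<subseteq> S" and P: "P \<in> \<Q>"
  shows "candidates U' S' (\<phi> ` M) ((`) \<phi> ` \<Q>) (\<phi> ` P) = \<phi> ` candidates U S M \<Q> P"
proof -
  have "\<phi> x \<in> candidates U' S' (\<phi> ` M) ((`) \<phi> ` \<Q>) (\<phi> ` P) \<longleftrightarrow> x \<in> candidates U S M \<Q> P"
    if x: "x \<in> S" for x
  proof -
    have "\<phi> x \<in> around U' S' (\<phi> ` M) \<longleftrightarrow> x \<in> around U S M"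
      unfolding around_image[OF M] using x by (intro mem_image_iff) (auto simp: around_def)
    moreover have "\<phi> x \<in> \<phi> ` R \<longleftrightarrow> x \<in> R" "\<phi> ` R = \<phi> ` P \<longleftrightarrow> R = P"
      "closely_related U' S' (star U' (\<phi> x)) (\<phi> ` R) \<longleftrightarrow> closely_related U S (star U x) R"
      if "R \<in> \<Q>" for R
      using that x Q P by (simp_all add: mem_image_iff image_eq star_eq closely_related_image)
    ultimately show ?thesis using P by (simp add: candidates_def)
  qed
  moreover have "candidates U S M \<Q> P \<subseteq> S"
    "candidates U' S' (\<phi> ` M) ((`) \<phi> ` \<Q>) (\<phi> ` P) \<subseteq> \<phi> ` S"
    unfolding candidates_def around_def image by blast+
  ultimately show ?thesis by blast
qed

lemma tops_image:
  assumes "M \<subseteq> S" "\<And>R. R \<in> \<Q> \<Longrightarrow> R \<subseteq> S" "P \<in> \<Q>"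
  shows "tops U' S' (\<phi> ` M) ((`) \<phi> ` \<Q>) (\<phi> ` P) = \<phi> ` tops U S M \<Q> P"
proof -
  let ?C = "candidates U S M \<Q> P"
  have "?C \<subseteq> S" unfolding candidates_def around_def by blast
  then have "\<phi> y \<sqsubseteq>\<^bsub>U'\<^esub> \<phi> x \<longleftrightarrow> y \<sqsubseteq>\<^bsub>U\<^esub> x" if "x \<in> ?C" "y \<in> ?C" for x y
    using that le_iff by blast
  moreover have "candidates U' S' (\<phi> ` M) ((`) \<phi> ` \<Q>) (\<phi> ` P) = \<phi> ` ?C"
    using candidates_image[of M \<Q> P] assms by simp
  ultimately show ?thesis unfolding tops_def by auto
qed

lemma run_image:
  assumes "\<And>P. P \<in> \<P> \<Longrightarrow> P \<subseteq> S"
  shows "fst (run U S \<P> n) \<subseteq> S \<and> snd (run U S \<P> n) \<subseteq> \<P> \<and>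
    run U' S' ((`) \<phi> ` \<P>) n = (\<phi> ` fst (run U S \<P> n), (`) \<phi> ` snd (run U S \<P> n))"
proof (induction n)
  case 0
  then show ?case by simp
next
  case (Suc n)
  obtain M \<Q> where run: "run U S \<P> n = (M, \<Q>)" by fastforce
  have M: "M \<subseteq> S" "\<Q> \<subseteq> \<P>" and run': "run U' S' ((`) \<phi> ` \<P>) n = (\<phi> ` M, (`) \<phi> ` \<Q>)"
    using Suc by (simp_all add: run)
  have tops: "tops U' S' (\<phi> ` M) ((`) \<phi> ` \<Q>) (\<phi> ` P) = \<phi> ` tops U S M \<Q> P" if "P \<in> \<Q>" for P
    by (rule tops_image) (use that M assms in blast)+
  have "new_separations U' S' (\<phi> ` M) ((`) \<phi> ` \<Q>) = \<phi> ` new_separations U S M \<Q>"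
    by (simp add: new_separations_def tops image_UN)
  moreover have "remaining U' S' (\<phi> ` M) ((`) \<phi> ` \<Q>) = (`) \<phi> ` remaining U S M \<Q>"
  proof -
    have "tops U' S' (\<phi> ` M) ((`) \<phi> ` \<Q>) (\<phi> ` P) = {} \<longleftrightarrow> tops U S M \<Q> P = {}" if "P \<in> \<Q>" for P
      by (simp add: tops that)
    then show ?thesis unfolding remaining_def by blast
  qed
  moreover have "new_separations U S M \<Q> \<subseteq> S"
    unfolding new_separations_def tops_def candidates_def around_def by blast
  moreover have "remaining U S M \<Q> \<subseteq> \<P>" using M(2) unfolding remaining_def by blast
  ultimately show ?case using M by (simp add: run run' image_Un)
qed

lemma nested_choice_image:
  assumes "\<And>P. P \<in> \<P> \<Longrightarrow> P \<subseteq> S"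
  shows "(`) \<phi> ` nested_choice U S \<P> = nested_choice U' S' ((`) \<phi> ` \<P>)"
proof -
  \<comment> \<open>Equally many profiles on both sides means equally many rounds.\<close>
  have "inj_on ((`) \<phi>) \<P>"
    by (rule inj_onI) (use image_eq assms in blast)
  then have c: "card ((`) \<phi> ` \<P>) = card \<P>" by (rule card_image)
  define M where "M = fst (run U S \<P> (card \<P>))"
  have M: "M \<subseteq> S" "fst (run U' S' ((`) \<phi> ` \<P>) (card \<P>)) = \<phi> ` M"
    using run_image[of \<P> "card \<P>"] assms by (simp_all add: M_def)
  have "\<phi> ` unor U r = unor U' (\<phi> r)" if "r \<in> M" for r
    using that M(1) star_eq[of r] by (auto simp: unor_def)
  then show ?thesis
    unfolding nested_choice_def c M(2) by (simp add: image_image flip: M_def)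
qed

end

lemma canonical_nested_choice: "canonical nested_choice nested_choice"
  unfolding canonical_def
proof (intro allI impI, elim conjE)
  fix U :: "'a sepsys" and S \<P> and U' :: "'b sepsys" and S' \<phi>
  assume fin: "finite S" "finite S'" and sub: "submodular U S" "submodular U' S'"
    and prof: "\<forall>P\<in>\<P>. profile U S P"
    and iso: "sepsys_iso (U\<lparr>carrier := S\<rparr>) (U'\<lparr>carrier := S'\<rparr>) \<phi>"
    and join: "\<forall>r\<in>S. \<forall>s\<in>S. (r \<squnion>\<^bsub>U\<^esub> s \<in> S) = (\<phi> r \<squnion>\<^bsub>U'\<^esub> \<phi> s \<in> S')"
  interpret A: submodular_system U S using submodular_systemI sub fin by blast
  interpret B: submodular_system U' S' using submodular_systemI sub fin by blast
  interpret system_iso U S U' S' \<phi>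
    using iso join by unfold_locales (auto simp: sepsys_iso_def bij_betw_def)
  show "(`) \<phi> ` nested_choice U S \<P> = nested_choice U' S' ((`) \<phi> ` \<P>)"
    by (rule nested_choice_image) (use prof A.prof_S in blast)
qed

text \<open>\<open>nested_choice\<close> is polymorphic, so its instances at the two types serve as
  \<open>N\<close> and \<open>N'\<close>, and one canonicity lemma covers all four
  combinations.\<close>

theorem theorem5p8:
  shows "\<exists>(N :: 'a sep_choice) (N' :: 'b sep_choice).
    chooses_good_nested_sets N \<and> chooses_good_nested_sets N' \<and>
    canonical N N \<and> canonical N N' \<and> canonical N' N \<and> canonical N' N'"
  by (intro exI[of _ nested_choice] conjI chooses_good_nested_sets_nested_choice canonical_nested_choice)

end
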